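(* Let $\mathbb{G}$ be a stratified Lie group of homogeneous dimension $Q$. Let $0<s<1<p<\infty$ with $Q>sp$, and put $p_s^*:=\frac{Qp}{Q-sp}$. Let $\Omega\subset\mathbb{G}$ be an open subset. Then the fractional Sobolev space $X_0^{s,p}(\Omega)$ is continuously embedded in $L^r(\Omega)$ for every $p\le r\le p_s^*$; that is, for each such $r$ there is a positive constant $C=C(Q,s,p,\Omega)$ such that for all $u\in X_0^{s,p}(\Omega)$, $$\|u\|_{L^r(\Omega)}\le C\,\|u\|_{X_0^{s,p}(\Omega)}.$$ Moreover, if $\Omega$ is bounded, then the embedding $X_0^{s,p}(\Omega)\hookrightarrow L^r(\Omega)$ is continuous for all $r\in[1,p_s^*]$ and compact for all $r\in[1,p_s^* )$.
   Context: Stratified Lie group: a Lie group $\mathbb{G}=(\mathbb{R}^N,\circ)$ with identity $0$ such that (i) there is a decomposition $\mathbb{R}^N=\mathbb{R}^{N_1}\times\cdots\times\mathbb{R}^{N_k}$ for which, for every $\lambda>0$, the dilation $D_\lambda(x)=(\lambda x^{(1)},\lambda^2x^{(2)},\dots,\lambda^kx^{(k)})$, $x^{(i)}\in\mathbb{R}^{N_i}$, is an automorphism of $\mathbb{G}$; (ii) if $X_1,\dots,X_{N_1}$ are the left-invariant vector fields with $X_j(0)=\partial/\partial x_j|_0$, then the Lie algebra generated by $X_1,\dots,X_{N_1}$ has rank $N$ at every point. The homogeneous dimension is $Q=\sum_{i=1}^k iN_i$. The Haar measure $dx$ is Lebesgue measure on $\mathbb{R}^N$. We write $xy$ for $x\circ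 y$ and fix a homogeneous quasi-norm $|\cdot|$ on $\mathbb{G}$: a continuous function $|\cdot|:\mathbb{G}\to[0,\infty)$ with $|x|=0$ iff $x=0$, $|x^{-1}|=|x|$, and $|D_\lambda x|=\lambda|x|$ for $\lambda>0$. Functions are real-valued. The Gagliardo seminorm is $[u]_{s,p,\mathbb{G}}:=\left(\iint_{\mathbb{G}\times\mathbb{G}}\frac{|u(x)-u(y)|^p}{|y^{-1}x|^{Q+ps}}\,dx\,dy\right)^{1/p}$. The space $X_0^{s,p}(\Omega)$ is the closure of $C_c^\infty(\Omega)$ with respect to the norm $\|u\|_{X_0^{s,p}(\Omega)}=\|u\|_{L^p(\Omega)}+[u]_{s,p,\mathbb{G}}$, functions being extended by $0$ to $\mathbb{G}\setminus\Omega$. *)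

theory Defs
  imports "HOL-Analysis.Analysis" "HOL-Algebra.Group"
begin

section \<open>Smooth maps and vector fields\<close>

primrec Ck_map :: "nat \<Rightarrow> ('a::euclidean_space \<Rightarrow> 'b::euclidean_space) \<Rightarrow> bool" where
  "Ck_map 0 f \<longleftrightarrow> continuous_on UNIV f"
| "Ck_map (Suc m) f \<longleftrightarrow> (\<forall>x. f differentiable (at x)) \<and>
     (\<forall>v. Ck_map m (\<lambda>x. frechet_derivative f (at x) v))"

definition smooth_map :: "('a::euclidean_space \<Rightarrow> 'b::euclidean_space) \<Rightarrow> bool" where
  "smooth_map f \<longleftrightarrow> (\<forall>m. Ck_map m f)"

text \<open>A vector field on \<open>\<real>\<^sup>N\<close> is given by its coefficient map; \<open>X\<close> acts on functions as
  the directional derivative along \<open>X x\<close>, so the commutator \<open>X Y - Y X\<close> has the coefficients below.\<close>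

definition lie_bracket :: "('a::euclidean_space \<Rightarrow> 'a) \<Rightarrow> ('a \<Rightarrow> 'a) \<Rightarrow> 'a \<Rightarrow> 'a" where
  "lie_bracket X Y x = frechet_derivative Y (at x) (X x) - frechet_derivative X (at x) (Y x)"

inductive_set generated_lie_algebra :: "('a::euclidean_space \<Rightarrow> 'a) set \<Rightarrow> ('a \<Rightarrow> 'a) set"
  for S :: "('a \<Rightarrow> 'a) set" where
  gen: "X \<in> S \<Longrightarrow> X \<in> generated_lie_algebra S"
| zero: "(\<lambda>x. 0) \<in> generated_lie_algebra S"
| add: "X \<in> generated_lie_algebra S \<Longrightarrow> Y \<in> generated_lie_algebra S \<Longrightarrow>
     (\<lambda>x. X x + Y x) \<in> generated_lie_algebra S"
| scale: "X \<in> generated_lie_algebra S \<Longrightarrow> (\<lambda>x. c *\<^sub>R X x) \<in> generated_lie_algebra S"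
| bracket: "X \<in> generated_lie_algebra S \<Longrightarrow> Y \<in> generated_lie_algebra S \<Longrightarrow>
     lie_bracket X Y \<in> generated_lie_algebra S"

definition left_invariant :: "(real^'n::finite) monoid \<Rightarrow> (real^'n \<Rightarrow> real^'n) \<Rightarrow> bool" where
  "left_invariant G X \<longleftrightarrow>
     (\<forall>x y. X (x \<otimes>\<^bsub>G\<^esub> y) = frechet_derivative (\<lambda>z. x \<otimes>\<^bsub>G\<^esub> z) (at y) (X y))"


section \<open>Stratified Lie groups\<close>

text \<open>The decomposition \<open>\<real>\<^sup>N = \<real>\<^bsup>N_1\<^esup> \<times> \<dots> \<times> \<real>\<^bsup>N_k\<^esup>\<close> is encoded by the map \<open>w\<close> that sends
  a coordinate to the number of the block containing it, so that \<open>N_i = card {j. w j = i}\<close>.\<close>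

definition dilation :: "('n \<Rightarrow> nat) \<Rightarrow> real \<Rightarrow> real^'n \<Rightarrow> real^'n::finite" where
  "dilation w t x = (\<chi> j. t ^ w j * x $ j)"

definition homogeneous_dim :: "nat \<Rightarrow> ('n::finite \<Rightarrow> nat) \<Rightarrow> nat" where
  "homogeneous_dim k w = (\<Sum>i = 1..k. i * card {j. w j = i})"

definition horizontal_fields ::
    "(real^'n::finite) monoid \<Rightarrow> ('n \<Rightarrow> nat) \<Rightarrow> (real^'n \<Rightarrow> real^'n) set" where
  "horizontal_fields G w = {X. left_invariant G X \<and> (\<exists>j. w j = 1 \<and> X 0 = axis j 1)}"

locale stratified_lie_group = group G
  for G :: "(real^'n::finite) monoid" (structure) +
  fixes k :: nat and w :: "'n \<Rightarrow> nat"
  assumes carrier_eq: "carrier G = UNIV"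
    and one_eq: "\<one> = 0"
    and smooth_mult: "smooth_map (\<lambda>z. fst z \<otimes> snd z)"
    and smooth_inv: "smooth_map (\<lambda>x. inv x)"
    and blocks: "w j \<in> {1..k}"
    and dilation_aut: "t > 0 \<Longrightarrow> dilation w t \<in> iso G G"
    and rank_condition:
      "dim {X x |X. X \<in> generated_lie_algebra (horizontal_fields G w)} = CARD('n)"

definition homogeneous_quasi_norm ::
    "(real^'n::finite) monoid \<Rightarrow> ('n \<Rightarrow> nat) \<Rightarrow> (real^'n \<Rightarrow> real) \<Rightarrow> bool" where
  "homogeneous_quasi_norm G w q \<longleftrightarrow>
     continuous_on UNIV q \<and> (\<forall>x. 0 \<le> q x) \<and> (\<forall>x. q x = 0 \<longleftrightarrow> x = 0) \<and>
     (\<forall>x. q (inv\<^bsub>G\<^esub> x) = q x) \<and> (\<forall>t>0. \<forall>x. q (dilation w t x) = t * q x)"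


section \<open>Function spaces\<close>

text \<open>Norms take values in \<open>[0,\<infinity>]\<close>, so that a divergent integral gives \<open>\<infinity>\<close> rather than the
  junk value 0. The power below is only used for positive exponents.\<close>

definition ennreal_pow :: "ennreal \<Rightarrow> real \<Rightarrow> ennreal" where
  "ennreal_pow a t = (if a = \<infinity> then \<infinity> else ennreal (enn2real a powr t))"

definition Lp_norm :: "real \<Rightarrow> (real^'n::finite) set \<Rightarrow> (real^'n \<Rightarrow> real) \<Rightarrow> ennreal" where
  "Lp_norm p \<Omega> u = ennreal_pow (\<integral>\<^sup>+x. ennreal (\<bar>u x\<bar> powr p) \<partial>lebesgue_on \<Omega>) (1 / p)"

definition Lp_space :: "real \<Rightarrow> (real^'n::finite) set \<Rightarrow> (real^'n \<Rightarrow> real) set" where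
  "Lp_space p \<Omega> = {u \<in> borel_measurable (lebesgue_on \<Omega>). Lp_norm p \<Omega> u < \<infinity>}"

text \<open>The diagonal, where the denominator vanishes, is a null set.\<close>

definition gagliardo_seminorm ::
    "(real^'n::finite) monoid \<Rightarrow> (real^'n \<Rightarrow> real) \<Rightarrow> nat \<Rightarrow> real \<Rightarrow> real \<Rightarrow> (real^'n \<Rightarrow> real) \<Rightarrow> ennreal"
  where
  "gagliardo_seminorm G q Q s p u = ennreal_pow
     (\<integral>\<^sup>+(x, y). ennreal (\<bar>u x - u y\<bar> powr p / q (inv\<^bsub>G\<^esub> y \<otimes>\<^bsub>G\<^esub> x) powr (real Q + p * s))
        \<partial>(lebesgue \<Otimes>\<^sub>M lebesgue)) (1 / p)"

definition X0_norm ::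
    "(real^'n::finite) monoid \<Rightarrow> (real^'n \<Rightarrow> real) \<Rightarrow> nat \<Rightarrow> real \<Rightarrow> real \<Rightarrow> (real^'n) set \<Rightarrow>
     (real^'n \<Rightarrow> real) \<Rightarrow> ennreal" where
  "X0_norm G q Q s p \<Omega> u = Lp_norm p \<Omega> u + gagliardo_seminorm G q Q s p u"

text \<open>Test functions on \<open>\<Omega>\<close>, extended by 0 to the whole space.\<close>

definition test_functions :: "(real^'n::finite) set \<Rightarrow> (real^'n \<Rightarrow> real) set" where
  "test_functions \<Omega> = {\<phi>. smooth_map \<phi> \<and> compact (closure {x. \<phi> x \<noteq> 0}) \<and> closure {x. \<phi> x \<noteq> 0} \<subseteq> \<Omega>}"

text \<open>The closure is taken among the measurable functions on the group that vanish outside \<open>\<Omega>\<close> and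
  have finite norm. This space is complete (Fatou), so the closure is also the abstract completion of
  the test functions. Elements are functions, not classes modulo equality almost everywhere.\<close>

definition X0_space ::
    "(real^'n::finite) monoid \<Rightarrow> (real^'n \<Rightarrow> real) \<Rightarrow> nat \<Rightarrow> real \<Rightarrow> real \<Rightarrow> (real^'n) set \<Rightarrow>
     (real^'n \<Rightarrow> real) set" where
  "X0_space G q Q s p \<Omega> =
     {u \<in> borel_measurable lebesgue. (\<forall>x. x \<notin> \<Omega> \<longrightarrow> u x = 0) \<and> X0_norm G q Q s p \<Omega> u < \<infinity> \<and>
        (\<forall>\<epsilon>>0. \<exists>\<phi>\<in>test_functions \<Omega>. X0_norm G q Q s p \<Omega> (\<lambda>x. u x - \<phi> x) < ennreal \<epsilon>)}"


section \<open>Embeddings\<close>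

definition continuous_embedding ::
    "('a \<Rightarrow> real) set \<Rightarrow> (('a \<Rightarrow> real) \<Rightarrow> ennreal) \<Rightarrow> ('a \<Rightarrow> real) set \<Rightarrow> (('a \<Rightarrow> real) \<Rightarrow> ennreal) \<Rightarrow> bool"
  where
  "continuous_embedding X nX Y nY \<longleftrightarrow>
     X \<subseteq> Y \<and> (\<exists>C>0. \<forall>u\<in>X. nY u \<le> ennreal C * nX u)"

text \<open>Every bounded sequence in \<open>X\<close> has a subsequence that converges in \<open>Y\<close>.\<close>

definition compact_embedding ::
    "('a \<Rightarrow> real) set \<Rightarrow> (('a \<Rightarrow> real) \<Rightarrow> ennreal) \<Rightarrow> ('a \<Rightarrow> real) set \<Rightarrow> (('a \<Rightarrow> real) \<Rightarrow> ennreal) \<Rightarrow> bool"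
  where
  "compact_embedding X nX Y nY \<longleftrightarrow>
     X \<subseteq> Y \<and>
     (\<forall>u :: nat \<Rightarrow> 'a \<Rightarrow> real. (\<forall>m. u m \<in> X) \<and> (\<exists>M::real. \<forall>m. nX (u m) \<le> ennreal M) \<longrightarrow>
        (\<exists>v\<in>Y. \<exists>\<sigma>. strict_mono \<sigma> \<and> (\<lambda>m. nY (\<lambda>x. u (\<sigma> m) x - v x)) \<longlonglongrightarrow> 0))"

end

(* Write |u x| = t. Every y in the ball B of radius r around x satisfies |u y| >= t/2 or
   |u x - u y| >= t/2, so the measure of B, which is a multiple of r^Q, is at most
   (2/t)^p* ||u||_p*^p* + (2/t)^p r^(Q+sp) F(x), where F(x) is the inner Gagliardo integral.
   Choosing r so that the first term is half of the measure gives t^p* <= C ||u||_p*^(p* s p / Q) F(x),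
   and integrating in x gives the Sobolev inequality when ||u||_p* is finite; truncation removes this
   restriction. Only the measure of balls enters: no triangle inequality, no maximal function and no
   density of test functions. The left translations preserve Lebesgue measure because their Jacobian
   is invariant under the dilations, which contract all points to the identity.

   For compactness, cover the domain by finitely many small balls. A function of bounded energy whose
   means over these balls are small is small in L^1, so a subsequence along which all means over
   countably many balls converge is Cauchy in L^1. It has a subsequence that converges almost
   everywhere, and the bound in L^p* turns this into convergence in L^r for r < p*. *)

theory Submission
  imports Defs "HOL-Complex_Analysis.Great_Picard"
begin

section \<open>Convergence in measure spaces\<close>

text \<open>Write a for the integral of |u|^crit and E for the Gagliardo integral. The balanced
  radius satisfies V r^Q = 2 (2/t)^crit a, so r is a power of a t^(-crit). The exponent
  \<open>crit\<close> is the one for which the resulting powers of t close up: p + crit s p / Q =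
  crit. Integration in x then gives a <= C a^(sp/Q) E. The unknown stands on both sides, with an
  exponent below 1 on the right because sp < Q; cancelling it requires a to be finite and leaves
  a^(p/crit) <= C E.

  Both the inequality and the compactness are proved on a sigma-finite measure space with a
  nonnegative kernel. The group supplies two scale-invariant facts: the measure of a quasi-ball, and
  a diameter of at most K times its radius. In the compactness argument the gain is a factor
  \<delta>^(ps) in front of the energy: of the Q + ps powers of the diameter, the measure of a ball
  of radius \<delta> cancels Q. So \<delta> is chosen from the energy bound, and afterwards only
  finitely many means have to be controlled.\<close>

lemma ennreal_between_0:
  assumes "(0::ennreal) < y"
  obtains \<epsilon> where "0 < \<epsilon>" "ennreal \<epsilon> < y"
proof (cases y)
  case (real b)
  then have "0 < b" using assms by simp
  then show ?thesis using real by (intro that[of "b / 2"]) (simp_all add: ennreal_less_iff)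
next
  case top
  then show ?thesis by (intro that[of 1]) simp_all
qed

text \<open>Interpolation of exponents at a height \<open>m\<close>: above it the factor |z|^(r - P)
  has a nonpositive exponent and is at most m^(r - P). This yields uniform tails and the comparison
  of lower exponents with the critical one.\<close>

lemma powr_split_at:
  fixes z m :: real
  assumes m: "0 < m" and r: "r \<le> P"
  shows "\<bar>z\<bar> \<le> m \<or> \<bar>z\<bar> powr r \<le> m powr (r - P) * \<bar>z\<bar> powr P"
proof (cases "\<bar>z\<bar> \<le> m")
  case False
  have "\<bar>z\<bar> powr r = \<bar>z\<bar> powr (r - P) * \<bar>z\<bar> powr P"
    by (simp add: powr_add[symmetric])
  also have "\<dots> \<le> m powr (r - P) * \<bar>z\<bar> powr P"
    using False m r by (intro mult_right_mono powr_mono2') auto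
  finally show ?thesis ..
qed simp

text \<open>Increments along the subsequence have L1 norms at most 2^(-k), so the sum of their
  absolute values is integrable and hence finite almost everywhere; at such points the telescoping
  series converges.\<close>

lemma L1_Cauchy_AE_convergent_subseq:
  fixes f :: "nat \<Rightarrow> 'a \<Rightarrow> real"
  assumes [measurable]: "\<And>n. f n \<in> borel_measurable M"
    and Cauchy: "\<And>\<epsilon>. 0 < \<epsilon> \<Longrightarrow>
      \<exists>N. \<forall>m\<ge>N. \<forall>n\<ge>N. (\<integral>\<^sup>+x. ennreal \<bar>f m x - f n x\<bar> \<partial>M) \<le> ennreal \<epsilon>"
  obtains \<tau> :: "nat \<Rightarrow> nat" where "strict_mono \<tau>" "AE x in M. convergent (\<lambda>n. f (\<tau> n) x)"
proof -
  have "\<forall>k. \<exists>N. \<forall>m\<ge>N. \<forall>n\<ge>N. (\<integral>\<^sup>+x. ennreal \<bar>f m x - f n x\<bar> \<partial>M) \<le> ennreal ((1/2) ^ k)"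
    using Cauchy by simp
  then obtain N where N: "\<And>k m n. N k \<le> m \<Longrightarrow> N k \<le> n \<Longrightarrow>
      (\<integral>\<^sup>+x. ennreal \<bar>f m x - f n x\<bar> \<partial>M) \<le> ennreal ((1/2) ^ k)"
    by metis
  \<comment> \<open>The summand \<open>k\<close> makes \<open>\<tau>\<close> strictly increasing; the sum dominates \<open>N k\<close>.\<close>
  define \<tau> where "\<tau> k = (\<Sum>i\<le>k. N i) + k" for k
  have \<tau>: "strict_mono \<tau>"
    by (rule strict_monoI_Suc) (simp add: \<tau>_def)
  have \<tau>_ge: "N k \<le> \<tau> k" for k
    using member_le_sum[of k "{..k}" N] by (simp add: \<tau>_def)
  have \<tau>_ge': "N k \<le> \<tau> (Suc k)" for k
    using \<tau>_ge[of k] strict_monoD[OF \<tau>, of k "Suc k"] by simp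
  let ?d = "\<lambda>k x. ennreal \<bar>f (\<tau> (Suc k)) x - f (\<tau> k) x\<bar>"
  have "(\<integral>\<^sup>+x. (\<Sum>k. ?d k x) \<partial>M) = (\<Sum>k. \<integral>\<^sup>+x. ?d k x \<partial>M)"
    by (rule nn_integral_suminf) measurable
  also have "\<dots> \<le> (\<Sum>k. ennreal ((1/2) ^ k))"
    by (intro suminf_le N \<tau>_ge \<tau>_ge') auto
  also have "\<dots> < \<infinity>"
    by (subst suminf_ennreal2) (auto simp: summable_geometric)
  finally have "AE x in M. (\<Sum>k. ?d k x) \<noteq> \<infinity>"
    by (intro nn_integral_PInf_AE) auto
  then have "AE x in M. convergent (\<lambda>n. f (\<tau> n) x)"
  proof eventually_elim
    case (elim x)
    have "summable (\<lambda>k. \<bar>f (\<tau> (Suc k)) x - f (\<tau> k) x\<bar>)"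
      using elim by (intro summable_suminf_not_top) auto
    then have "summable (\<lambda>k. f (\<tau> (Suc k)) x - f (\<tau> k) x)"
      by (rule summable_rabs_cancel)
    then have "convergent (\<lambda>n. \<Sum>k<n. f (\<tau> (Suc k)) x - f (\<tau> k) x)"
      by (simp add: summable_iff_convergent)
    then have "convergent (\<lambda>n. f (\<tau> n) x - f (\<tau> 0) x)"
      by (simp add: sum_lessThan_telescope[of "\<lambda>n. f (\<tau> n) x"])
    then have "convergent (\<lambda>n. (f (\<tau> n) x - f (\<tau> 0) x) + f (\<tau> 0) x)"
      by (intro convergent_add convergent_const)
    then show ?case by simp
  qed
  with \<tau> that show ?thesis by blast
qed

text \<open>As r < P, the bound with exponent \<open>P\<close> makes the part above a height
  \<open>T\<close> small uniformly in \<open>n\<close>. Below \<open>T\<close>, dominated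
  convergence applies with the majorant T^r on the set \<open>S\<close> of finite measure.\<close>

lemma vitali_convergence:
  fixes f :: "nat \<Rightarrow> 'a \<Rightarrow> real"
  assumes [measurable]: "\<And>n. f n \<in> borel_measurable M" "S \<in> sets M"
    and S: "emeasure M S < \<infinity>" "\<And>n x. x \<in> space M \<Longrightarrow> x \<notin> S \<Longrightarrow> f n x = 0"
    and lim: "AE x in M. (\<lambda>n. f n x) \<longlonglongrightarrow> 0"
    and bound: "\<And>n. (\<integral>\<^sup>+x. ennreal (\<bar>f n x\<bar> powr P) \<partial>M) \<le> ennreal c"
    and r: "0 < r" "r < P"
  shows "(\<lambda>n. \<integral>\<^sup>+x. ennreal (\<bar>f n x\<bar> powr r) \<partial>M) \<longlonglongrightarrow> 0"
proof -
  \<comment> \<open>Kept positive because \<open>T\<close> is found below by dividing by it.\<close>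
  define c' where "c' = max c 1"
  have c': "0 < c'" "ennreal c \<le> ennreal c'"
    by (auto simp: c'_def intro: ennreal_leI)
  have split: "(\<integral>\<^sup>+x. ennreal (\<bar>f n x\<bar> powr r) \<partial>M) \<le>
      (\<integral>\<^sup>+x. ennreal (min \<bar>f n x\<bar> T powr r) \<partial>M) + ennreal (T powr (r - P) * c')" if T: "0 < T" for n T
  proof -
    have pt: "\<bar>z\<bar> powr r \<le> min \<bar>z\<bar> T powr r + T powr (r - P) * \<bar>z\<bar> powr P" for z :: real
      using powr_split_at[OF T less_imp_le[OF r(2)], of z]
    proof
      assume "\<bar>z\<bar> \<le> T"
      then show ?thesis by (simp add: min_def)
    qed (simp add: add_increasing)
    have "(\<integral>\<^sup>+x. ennreal (\<bar>f n x\<bar> powr r) \<partial>M) \<le>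
        (\<integral>\<^sup>+x. ennreal (min \<bar>f n x\<bar> T powr r) + ennreal (T powr (r - P)) * ennreal (\<bar>f n x\<bar> powr P) \<partial>M)"
      using pt by (intro nn_integral_mono) (simp add: ennreal_mult'[symmetric] ennreal_plus[symmetric] del: ennreal_plus)
    also have "\<dots> = (\<integral>\<^sup>+x. ennreal (min \<bar>f n x\<bar> T powr r) \<partial>M) +
        ennreal (T powr (r - P)) * (\<integral>\<^sup>+x. ennreal (\<bar>f n x\<bar> powr P) \<partial>M)"
      by (simp add: nn_integral_add nn_integral_cmult)
    also have "\<dots> \<le> (\<integral>\<^sup>+x. ennreal (min \<bar>f n x\<bar> T powr r) \<partial>M) + ennreal (T powr (r - P)) * ennreal c'"
      by (intro add_left_mono mult_left_mono order_trans[OF bound c'(2)]) auto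
    finally show ?thesis
      using c' by (simp add: ennreal_mult'')
  qed
  have trunc: "(\<lambda>n. \<integral>\<^sup>+x. ennreal (min \<bar>f n x\<bar> T powr r) \<partial>M) \<longlonglongrightarrow> 0" if T: "0 < T" for T
  proof -
    have "(\<lambda>n. \<integral>\<^sup>+x. ennreal (min \<bar>f n x\<bar> T powr r) \<partial>M) \<longlonglongrightarrow> (\<integral>\<^sup>+x. 0 \<partial>M)"
    proof (rule nn_integral_dominated_convergence[where w = "\<lambda>x. ennreal (T powr r) * indicator S x"])
      show "AE x in M. ennreal (min \<bar>f n x\<bar> T powr r) \<le> ennreal (T powr r) * indicator S x" for n
        using S(2) T r by (intro AE_I2) (auto simp: indicator_def intro!: ennreal_leI powr_mono2)
      show "(\<integral>\<^sup>+x. ennreal (T powr r) * indicator S x \<partial>M) < \<infinity>"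
        using S(1) by (simp add: nn_integral_cmult_indicator ennreal_mult_less_top)
      show "AE x in M. (\<lambda>n. ennreal (min \<bar>f n x\<bar> T powr r)) \<longlonglongrightarrow> 0"
        using lim
      proof eventually_elim
        case (elim x)
        have "(\<lambda>n. min \<bar>f n x\<bar> T) \<longlonglongrightarrow> 0"
          using tendsto_min[OF tendsto_rabs[OF elim] tendsto_const[of T]] T by simp
        then have "(\<lambda>n. min \<bar>f n x\<bar> T powr r) \<longlonglongrightarrow> 0 powr r"
          using T r by (intro tendsto_powr2) auto
        then show ?case
          using r tendsto_ennrealI[of _ 0] by fastforce
      qed
    qed measurable
    then show ?thesis by simp
  qed
  show ?thesis
  proof (rule order_tendstoI)
    fix y :: ennreal assume "0 < y"
    then obtain \<epsilon> where \<epsilon>: "0 < \<epsilon>" "ennreal \<epsilon> < y" by (rule ennreal_between_0)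
    \<comment> \<open>Solves T^(r - P) c' = \<epsilon> / 2, so the tail takes half of the allowed
      error.\<close>
    define T where "T = (\<epsilon> / 2 / c') powr (1 / (r - P))"
    have T: "0 < T" using \<epsilon> c' by (simp add: T_def)
    have "T powr (r - P) = \<epsilon> / 2 / c'"
      using \<epsilon> c' r by (simp add: T_def powr_powr)
    then have Tc: "T powr (r - P) * c' = \<epsilon> / 2"
      using c' by simp
    have "\<forall>\<^sub>F n in sequentially. (\<integral>\<^sup>+x. ennreal (min \<bar>f n x\<bar> T powr r) \<partial>M) < ennreal (\<epsilon> / 2)"
      using \<epsilon> by (intro order_tendstoD(2)[OF trunc[OF T]]) auto
    then show "\<forall>\<^sub>F n in sequentially. (\<integral>\<^sup>+x. ennreal (\<bar>f n x\<bar> powr r) \<partial>M) < y"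
    proof eventually_elim
      case (elim n)
      have "(\<integral>\<^sup>+x. ennreal (\<bar>f n x\<bar> powr r) \<partial>M) \<le> (\<integral>\<^sup>+x. ennreal (min \<bar>f n x\<bar> T powr r) \<partial>M) + ennreal (\<epsilon> / 2)"
        using split[OF T, of n] by (simp add: Tc)
      also have "\<dots> \<le> ennreal (\<epsilon> / 2) + ennreal (\<epsilon> / 2)"
        using elim by (intro add_right_mono) simp
      also have "\<dots> = ennreal \<epsilon>"
        using \<epsilon> by (simp add: ennreal_plus[symmetric] del: ennreal_plus)
      finally show ?case using \<epsilon> by simp
    qed
  qed simp
qed

lemma powr_abs_diff_le:
  fixes a b P :: real
  assumes "0 < P"
  shows "\<bar>a - b\<bar> powr P \<le> 2 powr P * (\<bar>a\<bar> powr P + \<bar>b\<bar> powr P)"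
proof -
  have "\<bar>a - b\<bar> powr P \<le> (2 * max \<bar>a\<bar> \<bar>b\<bar>) powr P"
    using assms by (intro powr_mono2) auto
  also have "\<dots> = 2 powr P * max \<bar>a\<bar> \<bar>b\<bar> powr P"
    by (rule powr_mult)
  also have "\<dots> \<le> 2 powr P * (\<bar>a\<bar> powr P + \<bar>b\<bar> powr P)"
    by (intro mult_left_mono) (auto simp: max_def)
  finally show ?thesis .
qed

lemma nn_integral_powr_diff_le:
  fixes u v :: "'a \<Rightarrow> real"
  assumes [measurable]: "u \<in> borel_measurable M" "v \<in> borel_measurable M" and "0 < P"
  shows "(\<integral>\<^sup>+x. ennreal (\<bar>u x - v x\<bar> powr P) \<partial>M) \<le>
    ennreal (2 powr P) * ((\<integral>\<^sup>+x. ennreal (\<bar>u x\<bar> powr P) \<partial>M) + (\<integral>\<^sup>+x. ennreal (\<bar>v x\<bar> powr P) \<partial>M))"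
proof -
  have "(\<integral>\<^sup>+x. ennreal (\<bar>u x - v x\<bar> powr P) \<partial>M) \<le>
      (\<integral>\<^sup>+x. ennreal (2 powr P) * (ennreal (\<bar>u x\<bar> powr P) + ennreal (\<bar>v x\<bar> powr P)) \<partial>M)"
    using powr_abs_diff_le[OF \<open>0 < P\<close>]
    by (intro nn_integral_mono) (simp add: ennreal_mult'[symmetric] ennreal_plus[symmetric] del: ennreal_plus)
  then show ?thesis
    by (simp add: nn_integral_add nn_integral_cmult)
qed

section \<open>Sobolev inequality for kernels with large balls\<close>

text \<open>\<kappa> stands for the quasi-distance |y^(-1) x|, and \<open>ball_lower\<close> is
  where the dimension enters. Zeros of \<kappa> are confined to the diagonal, where the numerator of
  the difference quotient vanishes as well.\<close>

locale fractional_kernel = sigma_finite_measure M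
  for M :: "'a measure" +
  fixes \<kappa> :: "'a \<Rightarrow> 'a \<Rightarrow> real" and V Q s p :: real
  assumes kernel_measurable: "(\<lambda>z. \<kappa> (fst z) (snd z)) \<in> borel_measurable (M \<Otimes>\<^sub>M M)"
    and kernel_nonneg: "0 \<le> \<kappa> x y"
    and kernel_zero: "\<kappa> x y = 0 \<Longrightarrow> x = y"
    and ball_lower: "x \<in> space M \<Longrightarrow> 0 < r \<Longrightarrow>
      ennreal (V * r powr Q) \<le> emeasure M {y \<in> space M. \<kappa> x y < r}"
    and V_pos: "0 < V" and s_pos: "0 < s" and p_gt_1: "1 < p" and subcritical: "s * p < Q"
begin

definition crit :: real where "crit = Q * p / (Q - s * p)"

definition quotient :: "('a \<Rightarrow> real) \<Rightarrow> 'a \<Rightarrow> 'a \<Rightarrow> real" where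
  "quotient u x y = \<bar>u x - u y\<bar> powr p / \<kappa> x y powr (Q + p * s)"

definition energy :: "('a \<Rightarrow> real) \<Rightarrow> ennreal" where
  "energy u = (\<integral>\<^sup>+z. ennreal (quotient u (fst z) (snd z)) \<partial>(M \<Otimes>\<^sub>M M))"

lemma Q_pos: "0 < Q"
  using s_pos p_gt_1 subcritical by (smt (verit) mult_pos_pos)

lemma crit_gt: "p < crit"
proof -
  have "p * (Q - s * p) < Q * p"
    using s_pos p_gt_1 by (simp add: algebra_simps)
  then show ?thesis
    using subcritical by (simp add: crit_def pos_less_divide_eq)
qed

text \<open>The identity that singles out \<open>crit\<close>: the powers of 2 / |u x| produced by
  the choice of radius in \<open>pointwise_bound\<close> combine to the power
  \<open>crit\<close>.\<close>

lemma crit_exponent: "p + crit * (p * s / Q) = crit"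
  using subcritical Q_pos by (simp add: crit_def field_simps)

lemma quotient_nonneg: "0 \<le> quotient u x y"
  by (simp add: quotient_def)

lemma quotient_measurable [measurable]:
  assumes [measurable]: "u \<in> borel_measurable M"
  shows "(\<lambda>z. quotient u (fst z) (snd z)) \<in> borel_measurable (M \<Otimes>\<^sub>M M)"
  unfolding quotient_def using kernel_measurable by measurable

lemma kernel_measurable_section [measurable]:
  assumes "x \<in> space M"
  shows "\<kappa> x \<in> borel_measurable M"
proof -
  have "(\<lambda>y. (x, y)) \<in> M \<rightarrow>\<^sub>M M \<Otimes>\<^sub>M M"
    using assms by simp
  from measurable_compose[OF this kernel_measurable] show ?thesis by simp
qed

lemma quotient_measurable_section [measurable]:
  assumes [measurable]: "u \<in> borel_measurable M" "x \<in> space M"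
  shows "quotient u x \<in> borel_measurable M"
  unfolding quotient_def[abs_def] by measurable

lemma energy_eq_iterated:
  assumes [measurable]: "u \<in> borel_measurable M"
  shows "energy u = (\<integral>\<^sup>+x. \<integral>\<^sup>+y. ennreal (quotient u x y) \<partial>M \<partial>M)"
  unfolding energy_def
  by (subst nn_integral_fst[symmetric]) (auto intro!: nn_integral_cong)

text \<open>A Chebyshev estimate for both alternatives at once: at every point of the ball one of
  the two summands is at least 1, so integrating their sum bounds the measure of the ball.
  \<open>P\<close> is set to \<open>crit\<close> afterwards.\<close>

lemma level_bound:
  assumes [measurable]: "u \<in> borel_measurable M" and x [measurable]: "x \<in> space M"
    and t: "u x \<noteq> 0" and r: "0 < r" and P: "0 < P"
  shows "ennreal (V * r powr Q) \<le>
    ennreal ((2 / \<bar>u x\<bar>) powr P) * (\<integral>\<^sup>+y. ennreal (\<bar>u y\<bar> powr P) \<partial>M) +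
    ennreal ((2 / \<bar>u x\<bar>) powr p * r powr (Q + p * s)) * (\<integral>\<^sup>+y. ennreal (quotient u x y) \<partial>M)"
proof -
  let ?c = "(2 / \<bar>u x\<bar>) powr P" and ?d = "(2 / \<bar>u x\<bar>) powr p * r powr (Q + p * s)"
  let ?B = "{y \<in> space M. \<kappa> x y < r}"
  have pt: "1 \<le> ?c * \<bar>u y\<bar> powr P + ?d * quotient u x y" if y: "\<kappa> x y < r" for y
  proof (cases "\<bar>u x\<bar> \<le> 2 * \<bar>u y\<bar>")
    case True
    have "1 \<le> (2 / \<bar>u x\<bar> * \<bar>u y\<bar>) powr P"
      using True P t by (intro ge_one_powr_ge_zero) (auto simp: field_simps)
    also have "\<dots> = ?c * \<bar>u y\<bar> powr P"
      by (rule powr_mult)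
    finally show ?thesis
      using quotient_nonneg[of u x y] by (simp add: add_increasing2)
  next
    case False
    then have d: "\<bar>u x\<bar> \<le> 2 * \<bar>u x - u y\<bar>"
      using abs_triangle_ineq2[of "u x" "u y"] by argo
    \<comment> \<open>Positivity of \<kappa> x y matters: division by 0 would return 0 and the
      quotient would give no lower bound.\<close>
    have "x \<noteq> y" using False by auto
    then have k: "0 < \<kappa> x y"
      using kernel_nonneg[of x y] kernel_zero[of x y] by linarith
    have 1: "1 \<le> (2 / \<bar>u x\<bar> * \<bar>u x - u y\<bar>) powr p"
      using d t p_gt_1 by (intro ge_one_powr_ge_zero) (auto simp: field_simps)
    \<comment> \<open>Inside the ball r / \<kappa> x y is above 1; this factor supplies the
      denominator of the quotient at the price of r^(Q + ps).\<close>
    have 2: "1 \<le> (r / \<kappa> x y) powr (Q + p * s)"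
      using k y Q_pos p_gt_1 s_pos by (intro ge_one_powr_ge_zero) (auto simp: field_simps)
    have "1 \<le> (2 / \<bar>u x\<bar> * \<bar>u x - u y\<bar>) powr p * (r / \<kappa> x y) powr (Q + p * s)"
      using mult_mono[OF 1 2] by simp
    also have "\<dots> = ?d * quotient u x y"
      by (simp only: powr_mult[of "2 / \<bar>u x\<bar>"] powr_divide[of r] quotient_def) (simp add: field_simps)
    finally show ?thesis
      by (simp add: add_increasing)
  qed
  have "ennreal (V * r powr Q) \<le> emeasure M ?B"
    by (rule ball_lower[OF x r])
  also have "\<dots> = (\<integral>\<^sup>+y. indicator ?B y \<partial>M)"
    by (intro nn_integral_indicator[symmetric]) measurable
  also have "\<dots> \<le> (\<integral>\<^sup>+y. ennreal ?c * ennreal (\<bar>u y\<bar> powr P) + ennreal ?d * ennreal (quotient u x y) \<partial>M)"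
  proof (intro nn_integral_mono)
    fix y assume "y \<in> space M"
    show "indicator ?B y \<le> ennreal ?c * ennreal (\<bar>u y\<bar> powr P) + ennreal ?d * ennreal (quotient u x y)"
    proof (cases "y \<in> ?B")
      case True
      then have "ennreal 1 \<le> ennreal (?c * \<bar>u y\<bar> powr P + ?d * quotient u x y)"
        using pt[of y] by (intro ennreal_leI) auto
      then show ?thesis
        using True quotient_nonneg[of u x y] by (simp add: ennreal_mult'[symmetric] ennreal_plus[symmetric] del: ennreal_plus)
    qed simp
  qed
  also have "\<dots> = ennreal ?c * (\<integral>\<^sup>+y. ennreal (\<bar>u y\<bar> powr P) \<partial>M) + ennreal ?d * (\<integral>\<^sup>+y. ennreal (quotient u x y) \<partial>M)"
    by (simp add: nn_integral_add nn_integral_cmult)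
  finally show ?thesis .
qed

text \<open>2^crit comes from the level |u x| / 2. One factor 2 / V comes from r^Q = 2 X / V and its
  power ps / Q from r^(ps), with \<open>X\<close> and \<open>r\<close> as chosen in
  \<open>pointwise_bound\<close>.\<close>

definition sobolev_const :: real where
  "sobolev_const = 2 powr crit * (2 / V) powr (1 + p * s / Q)"

lemma sobolev_const_pos: "0 < sobolev_const"
  using V_pos by (simp add: sobolev_const_def)

lemma pointwise_bound:
  assumes [measurable]: "u \<in> borel_measurable M" and x: "x \<in> space M"
    and a: "0 < a" "(\<integral>\<^sup>+y. ennreal (\<bar>u y\<bar> powr crit) \<partial>M) = ennreal a"
  shows "ennreal (\<bar>u x\<bar> powr crit) \<le>
    ennreal (sobolev_const * a powr (p * s / Q)) * (\<integral>\<^sup>+y. ennreal (quotient u x y) \<partial>M)"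
proof (cases "u x = 0 \<or> (\<integral>\<^sup>+y. ennreal (quotient u x y) \<partial>M) = \<infinity>")
  \<comment> \<open>An infinite inner integral makes the right side infinite, because its
    coefficient is positive.\<close>
  case True
  then show ?thesis
    using a sobolev_const_pos crit_gt p_gt_1 by (auto simp: ennreal_mult_eq_top_iff ennreal_mult_top)
next
  case False
  then obtain f where f: "0 \<le> f" "(\<integral>\<^sup>+y. ennreal (quotient u x y) \<partial>M) = ennreal f"
    by (metis ennreal_cases infinity_ennreal_def)
  define t where "t = \<bar>u x\<bar>"
  have t: "0 < t" using False by (simp add: t_def)
  have P: "0 < crit" using crit_gt p_gt_1 by simp
  \<comment> \<open>\<open>X\<close> is the first term of \<open>level_bound\<close> for the
    exponent \<open>crit\<close>. The radius \<open>r\<close> makes the lower bound V r^Q equal to 2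
    X, so that half of it survives when \<open>X\<close> is absorbed.\<close>
  define X where "X = (2 / t) powr crit * a"
  have X: "0 < X" using t a by (simp add: X_def)
  define r where "r = (2 * X / V) powr (1 / Q)"
  have r: "0 < r" using X V_pos by (simp add: r_def)
  have rQ: "V * r powr Q = 2 * X"
    using X V_pos Q_pos by (simp add: r_def powr_powr)
  have rps: "r powr (p * s) = (2 / V) powr (p * s / Q) * (a powr (p * s / Q) * (2 / t) powr (crit * (p * s / Q)))"
  proof -
    have "r powr (p * s) = (2 / V * (a * (2 / t) powr crit)) powr (p * s / Q)"
      by (simp add: r_def powr_powr X_def mult_ac)
    also have "\<dots> = (2 / V) powr (p * s / Q) * (a * (2 / t) powr crit) powr (p * s / Q)"
      by (rule powr_mult)
    also have "(a * (2 / t) powr crit) powr (p * s / Q) = a powr (p * s / Q) * ((2 / t) powr crit) powr (p * s / Q)"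
      by (rule powr_mult)
    finally show ?thesis by (simp add: powr_powr)
  qed
  have "ennreal (2 * X) \<le> ennreal ((2 / t) powr crit) * ennreal a +
      ennreal ((2 / t) powr p * r powr (Q + p * s)) * ennreal f"
    using level_bound[OF assms(1) x _ r P] False by (simp add: rQ a f t_def)
  also have "\<dots> = ennreal (X + (2 / t) powr p * r powr (Q + p * s) * f)"
    using f a by (simp add: ennreal_mult'[symmetric] ennreal_plus[symmetric] X_def del: ennreal_plus)
  finally have "2 * X \<le> X + (2 / t) powr p * r powr (Q + p * s) * f"
    using f X by (subst (asm) ennreal_le_iff) auto
  then have "X \<le> (2 / t) powr p * (r powr Q * r powr (p * s)) * f"
    by (simp add: powr_add)
  also have "r powr Q = 2 * X / V" using rQ V_pos by (simp add: field_simps)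
  \<comment> \<open>As r^Q = 2 X / V, the right side is a multiple of \<open>X\<close> too; after
    cancelling, the radius is present only through r^(ps).\<close>
  finally have "X * 1 \<le> X * ((2 / t) powr p * (2 / V) * r powr (p * s) * f)"
    by (simp add: mult_ac)
  then have "1 \<le> (2 / t) powr p * (2 / V) * r powr (p * s) * f"
    using X by (subst (asm) mult_le_cancel_left_pos)
  also have "\<dots> = ((2 / t) powr p * (2 / t) powr (crit * (p * s / Q))) *
      ((2 / V) powr 1 * (2 / V) powr (p * s / Q)) * a powr (p * s / Q) * f"
    using V_pos by (simp add: rps mult_ac)
  also have "\<dots> = (2 / t) powr crit * (2 / V) powr (1 + p * s / Q) * a powr (p * s / Q) * f"
    by (simp only: powr_add[symmetric] crit_exponent)
  finally have "t powr crit * 1 \<le> t powr crit * ((2 / t) powr crit * (2 / V) powr (1 + p * s / Q) * a powr (p * s / Q) * f)"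
    by (intro mult_left_mono) auto
  also have "\<dots> = sobolev_const * a powr (p * s / Q) * f"
    using t by (simp add: sobolev_const_def powr_divide)
  finally show ?thesis
    using f sobolev_const_pos by (simp add: t_def ennreal_mult'[symmetric])
qed

text \<open>Integrating \<open>pointwise_bound\<close> gives a <= C a^(ps/Q) e. Finiteness of
  \<open>a\<close> permits cancelling a^(ps/Q), and 1 - ps/Q = p / crit is the exponent that
  stays.\<close>

lemma sobolev_finite:
  assumes [measurable]: "u \<in> borel_measurable M"
    and fin: "(\<integral>\<^sup>+y. ennreal (\<bar>u y\<bar> powr crit) \<partial>M) < \<infinity>"
    and e: "0 \<le> e" "energy u \<le> ennreal e"
  shows "(\<integral>\<^sup>+y. ennreal (\<bar>u y\<bar> powr crit) \<partial>M) \<le> ennreal ((sobolev_const * e) powr (crit / p))"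
proof -
  obtain a where a: "0 \<le> a" "(\<integral>\<^sup>+y. ennreal (\<bar>u y\<bar> powr crit) \<partial>M) = ennreal a"
    using fin by (metis ennreal_cases infinity_ennreal_def less_irrefl)
  show ?thesis
  proof (cases "a = 0")
    case False
    with a have a0: "0 < a" by simp
    have "ennreal a \<le> (\<integral>\<^sup>+x. ennreal (sobolev_const * a powr (p * s / Q)) * (\<integral>\<^sup>+y. ennreal (quotient u x y) \<partial>M) \<partial>M)"
      unfolding a(2)[symmetric] by (intro nn_integral_mono pointwise_bound a0 a) auto
    also have "\<dots> = ennreal (sobolev_const * a powr (p * s / Q)) * energy u"
      by (simp add: nn_integral_cmult energy_eq_iterated)
    also have "\<dots> \<le> ennreal (sobolev_const * a powr (p * s / Q)) * ennreal e"
      by (intro mult_left_mono e) auto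
    also have "\<dots> = ennreal (sobolev_const * a powr (p * s / Q) * e)"
      using e by (simp add: ennreal_mult'')
    finally have "a \<le> sobolev_const * a powr (p * s / Q) * e"
      using e sobolev_const_pos by (subst (asm) ennreal_le_iff) auto
    moreover have "a = a powr (p / crit) * a powr (p * s / Q)"
    proof -
      have "p / crit + p * s / Q = 1"
        using crit_exponent crit_gt p_gt_1 Q_pos by (simp add: field_simps)
      then show ?thesis using a0 by (simp add: powr_add[symmetric])
    qed
    ultimately have "a powr (p / crit) * a powr (p * s / Q) \<le> (sobolev_const * e) * a powr (p * s / Q)"
      by (simp add: mult_ac)
    then have "a powr (p / crit) \<le> sobolev_const * e"
      using a0 by simp
    then have "(a powr (p / crit)) powr (crit / p) \<le> (sobolev_const * e) powr (crit / p)"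
      using crit_gt p_gt_1 by (intro powr_mono2) auto
    then show ?thesis
      using a0 crit_gt p_gt_1 by (simp add: a powr_powr ennreal_leI)
  qed (simp add: a)
qed

text \<open>Meant for truncation, which contracts the differences of values.\<close>

lemma energy_mono:
  assumes "\<And>x y. \<bar>u x - u y\<bar> \<le> \<bar>v x - v y\<bar>"
  shows "energy u \<le> energy v"
  unfolding energy_def quotient_def using assms p_gt_1
  by (intro nn_integral_mono ennreal_leI divide_right_mono powr_mono2) auto

text \<open>The truncations of |u| are bounded and lie in L^p with p < crit, so
  \<open>sobolev_finite\<close> applies to them. Their energy is at most that of \<open>u\<close>,
  and Fatou's lemma removes the truncation.\<close>

lemma sobolev:
  assumes [measurable]: "u \<in> borel_measurable M"
    and fin: "(\<integral>\<^sup>+y. ennreal (\<bar>u y\<bar> powr p) \<partial>M) < \<infinity>"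
    and e: "0 \<le> e" "energy u \<le> ennreal e"
  shows "(\<integral>\<^sup>+y. ennreal (\<bar>u y\<bar> powr crit) \<partial>M) \<le> ennreal ((sobolev_const * e) powr (crit / p))"
proof -
  define T where "T n x = min \<bar>u x\<bar> (real n)" for n x
  have T_meas [measurable]: "T n \<in> borel_measurable M" for n
    unfolding T_def[abs_def] by measurable
  have T_fin: "(\<integral>\<^sup>+y. ennreal (\<bar>T n y\<bar> powr crit) \<partial>M) < \<infinity>" for n
  proof -
    have "\<bar>T n y\<bar> powr crit \<le> real n powr (crit - p) * \<bar>u y\<bar> powr p" for y
    proof -
      have "\<bar>T n y\<bar> powr crit = \<bar>T n y\<bar> powr (crit - p) * \<bar>T n y\<bar> powr p"
        by (simp add: powr_add[symmetric])
      also have "\<dots> \<le> real n powr (crit - p) * \<bar>u y\<bar> powr p"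
        using crit_gt p_gt_1 by (intro mult_mono powr_mono2) (auto simp: T_def)
      finally show ?thesis .
    qed
    then have "(\<integral>\<^sup>+y. ennreal (\<bar>T n y\<bar> powr crit) \<partial>M) \<le> (\<integral>\<^sup>+y. ennreal (real n powr (crit - p)) * ennreal (\<bar>u y\<bar> powr p) \<partial>M)"
      by (intro nn_integral_mono) (simp add: ennreal_mult'[symmetric])
    also have "\<dots> = ennreal (real n powr (crit - p)) * (\<integral>\<^sup>+y. ennreal (\<bar>u y\<bar> powr p) \<partial>M)"
      by (simp add: nn_integral_cmult)
    also have "\<dots> < \<infinity>"
      using fin by (simp add: ennreal_mult_less_top)
    finally show ?thesis .
  qed
  have T_e: "energy (T n) \<le> ennreal e" for n
    by (rule order_trans[OF energy_mono e(2)]) (simp add: T_def min_def abs_if)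
  have lim: "(\<lambda>n. ennreal (\<bar>T n x\<bar> powr crit)) \<longlonglongrightarrow> ennreal (\<bar>u x\<bar> powr crit)" for x
  proof (rule tendsto_eventually)
    obtain m :: nat where "\<bar>u x\<bar> \<le> real m" using real_arch_simple by blast
    then show "\<forall>\<^sub>F n in sequentially. ennreal (\<bar>T n x\<bar> powr crit) = ennreal (\<bar>u x\<bar> powr crit)"
      by (intro eventually_sequentiallyI[of m]) (simp add: T_def min_def)
  qed
  have "(\<integral>\<^sup>+y. ennreal (\<bar>u y\<bar> powr crit) \<partial>M) = (\<integral>\<^sup>+y. liminf (\<lambda>n. ennreal (\<bar>T n y\<bar> powr crit)) \<partial>M)"
    using lim_imp_Liminf[OF trivial_limit_sequentially lim] by simp
  also have "\<dots> \<le> liminf (\<lambda>n. \<integral>\<^sup>+y. ennreal (\<bar>T n y\<bar> powr crit) \<partial>M)"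
    by (intro nn_integral_liminf) measurable
  also have "\<dots> \<le> liminf (\<lambda>n::nat. ennreal ((sobolev_const * e) powr (crit / p)))"
    by (intro Liminf_mono always_eventually allI sobolev_finite T_meas T_fin e T_e)
  also have "\<dots> = ennreal ((sobolev_const * e) powr (crit / p))"
    by (simp add: Liminf_const)
  finally show ?thesis .
qed

section \<open>Functions with small means over small sets\<close>

lemma energy_diff_le:
  assumes [measurable]: "u \<in> borel_measurable M" "v \<in> borel_measurable M"
  shows "energy (\<lambda>x. u x - v x) \<le> ennreal (2 powr p) * (energy u + energy v)"
proof -
  have pt: "quotient (\<lambda>x. u x - v x) x y \<le> 2 powr p * (quotient u x y + quotient v x y)" for x y
  proof -
    have "\<bar>(u x - v x) - (u y - v y)\<bar> powr p \<le> 2 powr p * (\<bar>u x - u y\<bar> powr p + \<bar>v x - v y\<bar> powr p)"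
      using powr_abs_diff_le[of p "u x - u y" "v x - v y"] p_gt_1 by (simp add: algebra_simps)
    from divide_right_mono[OF this, of "\<kappa> x y powr (Q + p * s)"] show ?thesis
      by (simp add: quotient_def add_divide_distrib distrib_left)
  qed
  have "energy (\<lambda>x. u x - v x) \<le> (\<integral>\<^sup>+z. ennreal (2 powr p) *
      (ennreal (quotient u (fst z) (snd z)) + ennreal (quotient v (fst z) (snd z))) \<partial>(M \<Otimes>\<^sub>M M))"
    unfolding energy_def using pt quotient_nonneg
    by (intro nn_integral_mono) (simp add: ennreal_mult'[symmetric] ennreal_plus[symmetric] del: ennreal_plus)
  also have "\<dots> = ennreal (2 powr p) * (energy u + energy v)"
    by (simp add: nn_integral_add nn_integral_cmult energy_def)
  finally show ?thesis .
qed

text \<open>Up to its small mean over \<open>B\<close>, f x is the mean of f x - f y over y in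
  \<open>B\<close>, and the inner energy integral controls these differences since \<kappa> x y is
  at most \<open>d\<close>. Using \<open>b\<close> in place of the measure of \<open>B\<close> makes
  the coefficient the same for all sets of a cover.\<close>

lemma small_mean_pointwise:
  assumes f [measurable]: "integrable M f" and B [measurable]: "B \<in> sets M" and x: "x \<in> B"
    and fin: "emeasure M B < \<infinity>" and lower: "b \<le> measure M B" "0 < b"
    and d: "0 < d" and diam: "\<And>y. y \<in> B \<Longrightarrow> \<kappa> x y \<le> d"
    and a: "0 < a" and mean: "\<bar>LINT y:B|M. f y\<bar> \<le> a * measure M B"
  shows "ennreal \<bar>f x\<bar> \<le> ennreal (2 * a) +
    ennreal (a powr (1 - p) * d powr (Q + p * s) / b) * (\<integral>\<^sup>+y. ennreal (quotient f x y) \<partial>M)"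
proof -
  have x_sp: "x \<in> space M" using x B sets.sets_into_space by blast
  let ?m = "measure M B" and ?c = "a powr (1 - p) * d powr (Q + p * s)"
  let ?F = "\<integral>\<^sup>+y. ennreal (quotient f x y) \<partial>M"
  have m: "0 < ?m" using lower by simp
  \<comment> \<open>\<open>t \<le> a + a powr (1 - p) * t powr p\<close> takes the place of Jensen's inequality.\<close>
  have pt: "\<bar>f x - f y\<bar> \<le> a + ?c * quotient f x y" if y: "y \<in> B" for y
  proof (cases "\<bar>f x - f y\<bar> \<le> a")
    case True
    then show ?thesis using quotient_nonneg[of f x y] by (simp add: add_increasing2)
  next
    case False
    let ?t = "\<bar>f x - f y\<bar>"
    have "x \<noteq> y" using False a by auto
    then have k: "0 < \<kappa> x y"
      using kernel_nonneg[of x y] kernel_zero[of x y] by linarith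
    have "?t = ?t powr (1 - p) * ?t powr p"
      using False a by (simp add: powr_add[symmetric])
    also have "\<dots> \<le> a powr (1 - p) * ?t powr p"
      using False a p_gt_1 by (intro mult_right_mono powr_mono2') auto
    also have "\<dots> = a powr (1 - p) * (\<kappa> x y powr (Q + p * s) * quotient f x y)"
      using k by (simp add: quotient_def)
    also have "\<dots> \<le> a powr (1 - p) * (d powr (Q + p * s) * quotient f x y)"
      using diam[OF y] k Q_pos p_gt_1 s_pos quotient_nonneg
      by (intro mult_left_mono mult_right_mono powr_mono2) auto
    finally show ?thesis using a by (simp add: mult_ac)
  qed
  have int_f: "set_integrable M B f"
    using f B unfolding set_integrable_def by (rule integrable_mult_indicator[rotated])
  have int_c: "set_integrable M B (\<lambda>y. c)" for c :: real
    using B fin unfolding set_integrable_def by simp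
  have "ennreal (?m * \<bar>f x\<bar>) = ennreal \<bar>LINT y:B|M. f x\<bar>"
    using fin by (simp add: set_lebesgue_integral_def abs_mult less_top)
  \<comment> \<open>Each of the two integrals contributes \<open>a\<close> times the measure of
    \<open>B\<close>, the first through \<open>pt\<close> and the second through
    \<open>mean\<close>; hence the term 2 a.\<close>
  also have "(LINT y:B|M. f x) = (LINT y:B|M. f x - f y) + (LINT y:B|M. f y)"
    using set_integral_diff(2)[OF int_c int_f, of "f x"] by simp
  also have "ennreal \<bar>\<dots>\<bar> \<le> ennreal (\<bar>LINT y:B|M. f x - f y\<bar> + a * ?m)"
    using mean by (intro ennreal_leI) linarith
  also have "\<dots> = ennreal \<bar>LINT y:B|M. f x - f y\<bar> + ennreal (a * ?m)"
    using m a by simp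
  also have "ennreal \<bar>LINT y:B|M. f x - f y\<bar> \<le> (\<integral>\<^sup>+y. ennreal (norm (indicator B y *\<^sub>R (f x - f y))) \<partial>M)"
    unfolding set_lebesgue_integral_def real_norm_def[symmetric]
    using set_integral_diff(1)[OF int_c int_f, of "f x"]
    by (intro integral_norm_bound_ennreal) (simp add: set_integrable_def)
  also have "\<dots> \<le> (\<integral>\<^sup>+y. ennreal a * indicator B y + ennreal ?c * ennreal (quotient f x y) \<partial>M)"
    using pt quotient_nonneg a
    by (intro nn_integral_mono)
      (auto simp: indicator_def ennreal_mult'[symmetric] ennreal_plus[symmetric] simp del: ennreal_plus intro!: ennreal_leI)
  also have "\<dots> = ennreal a * emeasure M B + ennreal ?c * ?F"
    using x_sp by (simp add: nn_integral_add nn_integral_cmult)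
  also have "emeasure M B = ennreal ?m"
    using fin by (simp add: emeasure_eq_ennreal_measure)
  finally have main: "ennreal (?m * \<bar>f x\<bar>) \<le> ennreal (2 * a * ?m) + ennreal ?c * ?F"
    using a m by (simp add: ennreal_mult'[symmetric] add.commute add.left_commute ennreal_plus[symmetric] del: ennreal_plus)
      (simp add: add.assoc[symmetric] ennreal_plus[symmetric] mult.assoc del: ennreal_plus)
  show ?thesis
  proof (cases ?F)
    case (real F)
    then have "?m * \<bar>f x\<bar> \<le> 2 * a * ?m + ?c * F"
      using main a m by (simp add: ennreal_mult'[symmetric] ennreal_plus[symmetric] del: ennreal_plus)
    then have "\<bar>f x\<bar> \<le> 2 * a + ?c * F / ?m"
      using m by (simp add: field_simps)
    also have "?c * F / ?m \<le> ?c * F / b"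
      using lower m real by (intro divide_left_mono) auto
    finally show ?thesis
      using real a lower by (simp add: ennreal_mult'[symmetric] ennreal_plus[symmetric] ennreal_leI del: ennreal_plus)
  next
    case top
    then show ?thesis using a lower d by (simp add: ennreal_mult_top)
  qed
qed

text \<open>Each point of \<open>S\<close> uses any one set of the cover that contains it. The
  pointwise bound is the same for all these sets, so overlaps of the cover cost nothing.\<close>

lemma small_means_L1:
  assumes f [measurable]: "integrable M f" and S [measurable]: "S \<in> sets M"
    and \<B>: "\<And>B. B \<in> \<B> \<Longrightarrow> B \<in> sets M" "S \<subseteq> \<Union>\<B>" "\<And>B. B \<in> \<B> \<Longrightarrow> emeasure M B < \<infinity>"
      "\<And>B. B \<in> \<B> \<Longrightarrow> b \<le> measure M B"
      "\<And>B x y. B \<in> \<B> \<Longrightarrow> x \<in> B \<Longrightarrow> y \<in> B \<Longrightarrow> \<kappa> x y \<le> d"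
    and b: "0 < b" and d: "0 < d" and a: "0 < a"
    and mean: "\<And>B. B \<in> \<B> \<Longrightarrow> \<bar>LINT y:B|M. f y\<bar> \<le> a * measure M B"
  shows "(\<integral>\<^sup>+x\<in>S. ennreal \<bar>f x\<bar> \<partial>M) \<le>
    ennreal (2 * a) * emeasure M S + ennreal (a powr (1 - p) * d powr (Q + p * s) / b) * energy f"
proof -
  let ?c = "ennreal (a powr (1 - p) * d powr (Q + p * s) / b)"
  have f_meas [measurable]: "f \<in> borel_measurable M" using f by simp
  have "(\<integral>\<^sup>+x\<in>S. ennreal \<bar>f x\<bar> \<partial>M) \<le>
      (\<integral>\<^sup>+x. ennreal (2 * a) * indicator S x + ?c * (\<integral>\<^sup>+y. ennreal (quotient f x y) \<partial>M) \<partial>M)"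
  proof (intro nn_integral_mono)
    fix x assume "x \<in> space M"
    show "ennreal \<bar>f x\<bar> * indicator S x \<le>
        ennreal (2 * a) * indicator S x + ?c * (\<integral>\<^sup>+y. ennreal (quotient f x y) \<partial>M)"
    proof (cases "x \<in> S")
      case True
      then obtain B where "B \<in> \<B>" "x \<in> B" using \<B>(2) by blast
      then show ?thesis
        using small_mean_pointwise[OF f \<B>(1) _ \<B>(3) \<B>(4) b d \<B>(5) a mean] True by simp
    qed simp
  qed
  also have "\<dots> = ennreal (2 * a) * emeasure M S + ?c * energy f"
    by (simp add: nn_integral_add nn_integral_cmult energy_eq_iterated)
  finally show ?thesis .
qed

end

section \<open>Compactness on totally bounded domains\<close>

text \<open>The covering sets model quasi-balls of radius \<delta>, and \<open>K\<close> replaces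
  the metric factor 2 between radius and diameter.\<close>

locale totally_bounded_domain = fractional_kernel +
  fixes S :: "'a set" and K :: real
  assumes domain_measurable [measurable]: "S \<in> sets M" and domain_finite: "emeasure M S < \<infinity>"
    and K_pos: "0 < K"
    and covering: "0 < \<delta> \<Longrightarrow> \<exists>\<B>. finite \<B> \<and> S \<subseteq> \<Union>\<B> \<and> (\<forall>B\<in>\<B>. B \<in> sets M \<and>
      emeasure M B < \<infinity> \<and> V * \<delta> powr Q \<le> measure M B \<and> (\<forall>x\<in>B. \<forall>y\<in>B. \<kappa> x y \<le> K * \<delta>))"
begin

text \<open>For sets of diameter K \<delta> and measure at least V \<delta>^Q, the energy
  coefficient in \<open>small_means_L1\<close> is a constant times \<delta>^(ps). So
  \<open>a\<close> is fixed first, for the term with the measure of \<open>S\<close>, and \<delta>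
  next, for the energy term.\<close>

lemma finitely_many_means:
  assumes e: "0 \<le> e" and \<epsilon>: "0 < \<epsilon>"
  obtains \<B> \<eta> where "finite \<B>" "\<B> \<subseteq> sets M" "0 < \<eta>"
    "\<And>f. integrable M f \<Longrightarrow> energy f \<le> ennreal e \<Longrightarrow> (\<forall>B\<in>\<B>. \<bar>LINT y:B|M. f y\<bar> \<le> \<eta>) \<Longrightarrow>
      (\<integral>\<^sup>+x\<in>S. ennreal \<bar>f x\<bar> \<partial>M) \<le> ennreal \<epsilon>"
proof -
  \<comment> \<open>Makes 2 a times the measure of \<open>S\<close> at most \<epsilon> / 2; the
    added 1 covers the case of a null set.\<close>
  define a where "a = \<epsilon> / 4 / (measure M S + 1)"
  have S1: "0 < measure M S + 1" by (simp add: add_nonneg_pos)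
  then have a: "0 < a" using \<epsilon> by (simp add: a_def)
  define c where "c = a powr (1 - p) * K powr (Q + p * s) / V"
  have c: "0 < c" using a K_pos V_pos by (simp add: c_def)
  \<comment> \<open>Solves c \<delta>^(ps) (e + 1) = \<epsilon> / 2; the added 1 covers e =
    0.\<close>
  define \<delta> where "\<delta> = (\<epsilon> / (2 * c * (e + 1))) powr (1 / (p * s))"
  have \<delta>: "0 < \<delta>" using \<epsilon> c e by (simp add: \<delta>_def)
  have \<delta>_ps: "\<delta> powr (p * s) = \<epsilon> / (2 * c * (e + 1))"
    using \<epsilon> c e p_gt_1 s_pos by (simp add: \<delta>_def powr_powr)
  let ?b = "V * \<delta> powr Q"
  have b: "0 < ?b" using V_pos \<delta> by simp
  from covering[OF \<delta>] obtain \<B> where fin: "finite \<B>" and cov: "S \<subseteq> \<Union>\<B>"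
    and all: "\<forall>B\<in>\<B>. B \<in> sets M \<and> emeasure M B < \<infinity> \<and> ?b \<le> measure M B \<and> (\<forall>x\<in>B. \<forall>y\<in>B. \<kappa> x y \<le> K * \<delta>)"
    by (elim exE conjE)
  have \<B>: "\<And>B. B \<in> \<B> \<Longrightarrow> B \<in> sets M" "\<And>B. B \<in> \<B> \<Longrightarrow> emeasure M B < \<infinity>"
    "\<And>B. B \<in> \<B> \<Longrightarrow> ?b \<le> measure M B"
    "\<And>B x y. B \<in> \<B> \<Longrightarrow> x \<in> B \<Longrightarrow> y \<in> B \<Longrightarrow> \<kappa> x y \<le> K * \<delta>"
    using all by simp_all
  \<comment> \<open>The threshold \<open>a * ?b\<close> lies below \<open>a * measure M B\<close>
    for every \<open>B\<close> of the cover and thus serves as the single \<eta>.\<close>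
  have "(\<integral>\<^sup>+x\<in>S. ennreal \<bar>f x\<bar> \<partial>M) \<le> ennreal \<epsilon>"
    if f: "integrable M f" and ef: "energy f \<le> ennreal e" and mean: "\<forall>B\<in>\<B>. \<bar>LINT y:B|M. f y\<bar> \<le> a * ?b" for f
  proof -
    have mean': "\<bar>LINT y:B|M. f y\<bar> \<le> a * measure M B" if "B \<in> \<B>" for B
    proof -
      have "\<bar>LINT y:B|M. f y\<bar> \<le> a * ?b" using mean that by blast
      also have "\<dots> \<le> a * measure M B" using \<B>(3)[OF that] a by (intro mult_left_mono) auto
      finally show ?thesis .
    qed
    have coeff: "a powr (1 - p) * (K * \<delta>) powr (Q + p * s) / ?b = c * \<delta> powr (p * s)"
    proof -
      have "(K * \<delta>) powr (Q + p * s) = K powr (Q + p * s) * (\<delta> powr Q * \<delta> powr (p * s))"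
        by (simp only: powr_mult powr_add mult.assoc mult.left_commute)
      then show ?thesis using \<delta> V_pos by (simp add: c_def)
    qed
    have "(\<integral>\<^sup>+x\<in>S. ennreal \<bar>f x\<bar> \<partial>M) \<le> ennreal (2 * a) * emeasure M S + ennreal (c * \<delta> powr (p * s)) * energy f"
      using small_means_L1[OF f domain_measurable \<B>(1) cov \<B>(2-4) b _ a mean'] K_pos \<delta>
      by (simp add: coeff)
    also have "\<dots> \<le> ennreal (2 * a) * ennreal (measure M S) + ennreal (c * \<delta> powr (p * s)) * ennreal e"
      using ef domain_finite by (intro add_mono mult_left_mono) (auto simp: emeasure_eq_ennreal_measure)
    also have "\<dots> = ennreal (2 * a * measure M S + c * \<delta> powr (p * s) * e)"
      using a c e by (simp add: ennreal_mult'[symmetric] ennreal_plus[symmetric] del: ennreal_plus)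
    also have "\<dots> \<le> ennreal \<epsilon>"
    proof (rule ennreal_leI)
      have "2 * a * measure M S \<le> 2 * a * (measure M S + 1)" using a by simp
      also have "\<dots> = \<epsilon> / 2"
        using nonzero_eq_divide_eq[of "measure M S + 1" a "\<epsilon> / 4"] S1 a_def by linarith
      finally have 1: "2 * a * measure M S \<le> \<epsilon> / 2" .
      have "0 < e + 1" using e by simp
      have "c * \<delta> powr (p * s) * e \<le> c * \<delta> powr (p * s) * (e + 1)"
        using c by (intro mult_left_mono) auto
      also have "\<dots> = \<epsilon> / 2"
        unfolding \<delta>_ps using c \<open>0 < e + 1\<close> by (simp del: distrib_left_numeral)
      finally show "2 * a * measure M S + c * \<delta> powr (p * s) * e \<le> \<epsilon>" using 1 by simp
    qed
    finally show ?thesis .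
  qed
  moreover have "\<B> \<subseteq> sets M" using \<B>(1) by (rule subsetI)
  moreover have "0 < a * ?b" using a b by simp
  ultimately show ?thesis using fin by (intro that[of \<B> "a * ?b"])
qed

lemma integrable_of_powr:
  assumes [measurable]: "u \<in> borel_measurable M"
    and zero: "\<And>x. x \<notin> S \<Longrightarrow> u x = 0"
    and bound: "(\<integral>\<^sup>+x. ennreal (\<bar>u x\<bar> powr p) \<partial>M) \<le> ennreal e" and e: "0 \<le> e"
  shows "integrable M u" "(\<integral>\<^sup>+x. ennreal \<bar>u x\<bar> \<partial>M) \<le> ennreal (measure M S + e)"
proof -
  have pt: "\<bar>z\<bar> \<le> 1 + \<bar>z\<bar> powr p" for z :: real
  proof (cases "\<bar>z\<bar> \<le> 1")
    case False
    then have "\<bar>z\<bar> powr 1 \<le> \<bar>z\<bar> powr p" using p_gt_1 by (intro powr_mono) auto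
    then show ?thesis using False by simp
  qed (simp add: add_increasing2)
  have "(\<integral>\<^sup>+x. ennreal \<bar>u x\<bar> \<partial>M) \<le> (\<integral>\<^sup>+x. indicator S x + ennreal (\<bar>u x\<bar> powr p) \<partial>M)"
  proof (intro nn_integral_mono)
    fix x assume "x \<in> space M"
    then show "ennreal \<bar>u x\<bar> \<le> indicator S x + ennreal (\<bar>u x\<bar> powr p)"
      using zero[of x] ennreal_leI[OF pt[of "u x"]] by (cases "x \<in> S") auto
  qed
  also have "\<dots> = emeasure M S + (\<integral>\<^sup>+x. ennreal (\<bar>u x\<bar> powr p) \<partial>M)"
    by (simp add: nn_integral_add)
  also have "\<dots> \<le> ennreal (measure M S) + ennreal e"
    using domain_finite bound by (intro add_mono) (auto simp: emeasure_eq_ennreal_measure)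
  also have "\<dots> = ennreal (measure M S + e)"
    using e by simp
  finally show *: "(\<integral>\<^sup>+x. ennreal \<bar>u x\<bar> \<partial>M) \<le> ennreal (measure M S + e)" .
  show "integrable M u"
    using order_le_less_trans[OF * ennreal_less_top] by (intro integrableI_bounded) auto
qed

text \<open>A diagonal subsequence makes the means over all sets of countably many finite covers
  converge. Differences of its late members then have small means over the k-th cover, hence L1 norm
  at most 1 / (k + 1) on \<open>S\<close>.\<close>

lemma L1_Cauchy_subseq:
  fixes u :: "nat \<Rightarrow> 'a \<Rightarrow> real"
  assumes [measurable]: "\<And>m. u m \<in> borel_measurable M"
    and zero: "\<And>m x. x \<notin> S \<Longrightarrow> u m x = 0"
    and bound: "\<And>m. (\<integral>\<^sup>+x. ennreal (\<bar>u m x\<bar> powr p) \<partial>M) \<le> ennreal e"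
    and energy: "\<And>m. energy (u m) \<le> ennreal e" and e: "0 \<le> e"
  obtains \<sigma> :: "nat \<Rightarrow> nat" where "strict_mono \<sigma>"
    "\<forall>\<epsilon>>0. \<exists>N. \<forall>m\<ge>N. \<forall>n\<ge>N. (\<integral>\<^sup>+x. ennreal \<bar>u (\<sigma> m) x - u (\<sigma> n) x\<bar> \<partial>M) \<le> ennreal \<epsilon>"
proof -
  \<comment> \<open>The energy bound of \<open>energy_diff_le\<close> for the difference of two
    members, to which \<open>finitely_many_means\<close> is applied.\<close>
  let ?e = "2 powr p * (e + e)"
  note int = integrable_of_powr[OF assms(1) zero bound e]
  define good where "good k \<B> \<eta> \<longleftrightarrow> finite \<B> \<and> \<B> \<subseteq> sets M \<and> 0 < \<eta> \<and>
    (\<forall>f. integrable M f \<longrightarrow> energy f \<le> ennreal ?e \<longrightarrow> (\<forall>B\<in>\<B>. \<bar>LINT y:B|M. f y\<bar> \<le> \<eta>) \<longrightarrow>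
      (\<integral>\<^sup>+x\<in>S. ennreal \<bar>f x\<bar> \<partial>M) \<le> ennreal (1 / Suc k))" for k :: nat and \<B> \<eta>
  have "\<exists>\<B> \<eta>. good k \<B> \<eta>" for k
  proof -
    have "0 \<le> ?e" "0 < 1 / real (Suc k)" using e by auto
    then show ?thesis
      by (rule finitely_many_means) (use good_def in blast)
  qed
  then obtain \<B> \<eta> where "\<And>k. good k (\<B> k) (\<eta> k)"
    by metis
  then have \<B>: "\<And>k. finite (\<B> k)" "\<And>k::nat. \<B> k \<subseteq> sets M" "\<And>k. 0 < \<eta> k"
    "\<And>k f. integrable M f \<Longrightarrow> energy f \<le> ennreal ?e \<Longrightarrow> (\<forall>B\<in>\<B> k. \<bar>LINT y:B|M. f y\<bar> \<le> \<eta> k) \<Longrightarrow>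
      (\<integral>\<^sup>+x\<in>S. ennreal \<bar>f x\<bar> \<partial>M) \<le> ennreal (1 / Suc k)"
    by (simp_all add: good_def)
  have mean_bound: "norm (LINT y:B|M. u m y) \<le> measure M S + e" if "B \<in> (\<Union>k. \<B> k)" for B m
  proof -
    have B [measurable]: "B \<in> sets M" using that \<B>(2) by blast
    have "ennreal (norm (LINT y:B|M. u m y)) \<le> (\<integral>\<^sup>+y. ennreal (norm (indicator B y *\<^sub>R u m y)) \<partial>M)"
      unfolding set_lebesgue_integral_def using int(1)
      by (intro integral_norm_bound_ennreal integrable_mult_indicator) auto
    also have "\<dots> \<le> (\<integral>\<^sup>+y. ennreal \<bar>u m y\<bar> \<partial>M)"
      by (intro nn_integral_mono ennreal_leI) (auto simp: indicator_def)
    also have "\<dots> \<le> ennreal (measure M S + e)" by (rule int(2))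
    finally show ?thesis using e by (subst (asm) ennreal_le_iff) (auto intro: add_nonneg_nonneg)
  qed
  have "countable (\<Union>k. \<B> k)"
    using \<B>(1) by (intro countable_UN) (auto intro: countable_finite)
  \<comment> \<open>The means are read as functions on a countable family of sets, bounded at each
    set; \<open>function_convergent_subsequence\<close> is the diagonal extraction for such
    functions.\<close>
  then obtain \<sigma> :: "nat \<Rightarrow> nat" where \<sigma>: "strict_mono \<sigma>"
      and lim: "\<And>B. B \<in> (\<Union>k. \<B> k) \<Longrightarrow> \<exists>l. (\<lambda>m. LINT y:B|M. u (\<sigma> m) y) \<longlonglongrightarrow> l"
    by (rule function_convergent_subsequence[of "\<Union>k. \<B> k" "\<lambda>m B. LINT y:B|M. u m y", OF _ mean_bound]) auto
  show ?thesis
  proof (rule that[OF \<sigma>], intro allI impI)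
    fix \<epsilon> :: real assume "0 < \<epsilon>"
    then obtain k where k: "1 / real (Suc k) < \<epsilon>" using nat_approx_posE by blast
    have "\<forall>B\<in>\<B> k. \<exists>N. \<forall>m\<ge>N. \<forall>n\<ge>N. \<bar>(LINT y:B|M. u (\<sigma> m) y) - (LINT y:B|M. u (\<sigma> n) y)\<bar> < \<eta> k"
    proof
      fix B assume "B \<in> \<B> k"
      then have "Cauchy (\<lambda>m. LINT y:B|M. u (\<sigma> m) y)"
        using lim[of B] by (auto intro: LIMSEQ_imp_Cauchy)
      from CauchyD[OF this \<B>(3)[of k]]
      show "\<exists>N. \<forall>m\<ge>N. \<forall>n\<ge>N. \<bar>(LINT y:B|M. u (\<sigma> m) y) - (LINT y:B|M. u (\<sigma> n) y)\<bar> < \<eta> k"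
        by simp
    qed
    then obtain N where N: "\<And>B m n. B \<in> \<B> k \<Longrightarrow> m \<ge> N B \<Longrightarrow> n \<ge> N B \<Longrightarrow>
        \<bar>(LINT y:B|M. u (\<sigma> m) y) - (LINT y:B|M. u (\<sigma> n) y)\<bar> < \<eta> k"
      by metis
    \<comment> \<open>The sum over the finite cover dominates every \<open>N B\<close> and is a
      common threshold.\<close>
    have "(\<integral>\<^sup>+x. ennreal \<bar>u (\<sigma> m) x - u (\<sigma> n) x\<bar> \<partial>M) \<le> ennreal \<epsilon>"
      if m: "m \<ge> (\<Sum>B\<in>\<B> k. N B)" and n: "n \<ge> (\<Sum>B\<in>\<B> k. N B)" for m n
    proof -
      let ?f = "\<lambda>x. u (\<sigma> m) x - u (\<sigma> n) x"
      have "energy ?f \<le> ennreal (2 powr p) * (energy (u (\<sigma> m)) + energy (u (\<sigma> n)))"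
        by (rule energy_diff_le) auto
      also have "\<dots> \<le> ennreal (2 powr p) * (ennreal e + ennreal e)"
        by (intro mult_left_mono add_mono energy) auto
      also have "\<dots> = ennreal ?e"
        using e by (simp add: ennreal_mult'[symmetric] ennreal_plus[symmetric] del: ennreal_plus)
      finally have en: "energy ?f \<le> ennreal ?e" .
      have "\<bar>LINT y:B|M. ?f y\<bar> \<le> \<eta> k" if B: "B \<in> \<B> k" for B
      proof -
        have [measurable]: "B \<in> sets M" using B \<B>(2) by blast
        have "N B \<le> (\<Sum>B\<in>\<B> k. N B)" by (rule member_le_sum[OF B _ \<B>(1)]) simp
        moreover have "(LINT y:B|M. ?f y) = (LINT y:B|M. u (\<sigma> m) y) - (LINT y:B|M. u (\<sigma> n) y)"
          unfolding set_integrable_def by (intro set_integral_diff(2)) (auto simp: set_integrable_def simp del: real_scaleR_def intro!: integrable_mult_indicator int(1))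
        ultimately show ?thesis using N[OF B, of m n] m n by simp
      qed
      then have "(\<integral>\<^sup>+x\<in>S. ennreal \<bar>?f x\<bar> \<partial>M) \<le> ennreal (1 / Suc k)"
        using int(1) en by (intro \<B>(4)) auto
      also have "\<dots> \<le> ennreal \<epsilon>" using k by (intro ennreal_leI) simp
      also have "(\<integral>\<^sup>+x\<in>S. ennreal \<bar>?f x\<bar> \<partial>M) = (\<integral>\<^sup>+x. ennreal \<bar>?f x\<bar> \<partial>M)"
        using zero by (intro nn_integral_cong) (auto simp: indicator_def)
      finally show ?thesis .
    qed
    then show "\<exists>N. \<forall>m\<ge>N. \<forall>n\<ge>N. (\<integral>\<^sup>+x. ennreal \<bar>u (\<sigma> m) x - u (\<sigma> n) x\<bar> \<partial>M) \<le> ennreal \<epsilon>"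
      by blast
  qed
qed

text \<open>One subsequence and one limit serve all exponents below \<open>crit\<close>. The members
  are bounded in the critical space by \<open>sobolev\<close>, Fatou's lemma passes this bound to
  the almost everywhere limit, and \<open>vitali_convergence\<close> applies to the
  differences.\<close>

lemma compactness:
  fixes u :: "nat \<Rightarrow> 'a \<Rightarrow> real"
  assumes [measurable]: "\<And>m. u m \<in> borel_measurable M"
    and zero: "\<And>m x. x \<notin> S \<Longrightarrow> u m x = 0"
    and bound: "\<And>m. (\<integral>\<^sup>+x. ennreal (\<bar>u m x\<bar> powr p) \<partial>M) \<le> ennreal e"
    and energy: "\<And>m. energy (u m) \<le> ennreal e" and e: "0 \<le> e"
  obtains \<sigma> :: "nat \<Rightarrow> nat" and v where "strict_mono \<sigma>" "v \<in> borel_measurable M"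
    "(\<integral>\<^sup>+x. ennreal (\<bar>v x\<bar> powr crit) \<partial>M) < \<infinity>" "\<forall>x. x \<notin> S \<longrightarrow> v x = 0"
    "\<forall>r>0. r < crit \<longrightarrow> (\<lambda>m. \<integral>\<^sup>+x. ennreal (\<bar>u (\<sigma> m) x - v x\<bar> powr r) \<partial>M) \<longlonglongrightarrow> 0"
proof -
  obtain \<sigma>1 :: "nat \<Rightarrow> nat" where \<sigma>1: "strict_mono \<sigma>1" and Cauchy:
    "\<forall>\<epsilon>>0. \<exists>N. \<forall>m\<ge>N. \<forall>n\<ge>N. (\<integral>\<^sup>+x. ennreal \<bar>u (\<sigma>1 m) x - u (\<sigma>1 n) x\<bar> \<partial>M) \<le> ennreal \<epsilon>"
    by (rule L1_Cauchy_subseq[OF assms(1) zero bound energy e])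
  obtain \<tau> :: "nat \<Rightarrow> nat" where \<tau>: "strict_mono \<tau>" "AE x in M. convergent (\<lambda>n. u (\<sigma>1 (\<tau> n)) x)"
    by (rule L1_Cauchy_AE_convergent_subseq[of "\<lambda>n. u (\<sigma>1 n)" M]) (use Cauchy in auto)
  define \<sigma> where "\<sigma> = \<sigma>1 \<circ> \<tau>"
  \<comment> \<open>\<open>lim\<close> has a value at every point, unspecified only on the null set
    where the sequence diverges.\<close>
  define v where "v x = lim (\<lambda>n. u (\<sigma> n) x)" for x
  define c where "c = (sobolev_const * e) powr (crit / p)"
  have crit: "0 < crit" using crit_gt p_gt_1 by simp
  have \<sigma>: "strict_mono \<sigma>"
    unfolding \<sigma>_def by (intro strict_mono_o \<sigma>1 \<tau>)
  have v_meas [measurable]: "v \<in> borel_measurable M"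
    unfolding v_def[abs_def] by measurable
  have v_zero: "v x = 0" if "x \<notin> S" for x
    using zero[OF that] by (simp add: v_def)
  have lim: "AE x in M. (\<lambda>n. u (\<sigma> n) x) \<longlonglongrightarrow> v x"
    using \<tau>(2) by eventually_elim (simp add: v_def \<sigma>_def convergent_LIMSEQ_iff)
  have u_crit: "(\<integral>\<^sup>+x. ennreal (\<bar>u m x\<bar> powr crit) \<partial>M) \<le> ennreal c" for m
    unfolding c_def using order_le_less_trans[OF bound ennreal_less_top]
    by (intro sobolev e energy) auto
  have "(\<integral>\<^sup>+x. ennreal (\<bar>v x\<bar> powr crit) \<partial>M) = (\<integral>\<^sup>+x. liminf (\<lambda>n. ennreal (\<bar>u (\<sigma> n) x\<bar> powr crit)) \<partial>M)"
  proof (intro nn_integral_cong_AE, use lim in eventually_elim)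
    case (elim x)
    have "(\<lambda>n. ennreal (\<bar>u (\<sigma> n) x\<bar> powr crit)) \<longlonglongrightarrow> ennreal (\<bar>v x\<bar> powr crit)"
      using elim crit by (intro tendsto_ennrealI tendsto_powr2 tendsto_rabs tendsto_const) auto
    from lim_imp_Liminf[OF trivial_limit_sequentially this] show ?case by (rule sym)
  qed
  also have "\<dots> \<le> liminf (\<lambda>n. \<integral>\<^sup>+x. ennreal (\<bar>u (\<sigma> n) x\<bar> powr crit) \<partial>M)"
    by (intro nn_integral_liminf) measurable
  also have "\<dots> \<le> liminf (\<lambda>n::nat. ennreal c)"
    by (intro Liminf_mono always_eventually allI u_crit)
  finally have v_crit: "(\<integral>\<^sup>+x. ennreal (\<bar>v x\<bar> powr crit) \<partial>M) \<le> ennreal c"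
    by (simp add: Liminf_const)
  have diff: "(\<integral>\<^sup>+x. ennreal (\<bar>u (\<sigma> n) x - v x\<bar> powr crit) \<partial>M) \<le> ennreal (2 powr crit * (c + c))" for n
  proof -
    have "(\<integral>\<^sup>+x. ennreal (\<bar>u (\<sigma> n) x - v x\<bar> powr crit) \<partial>M) \<le> ennreal (2 powr crit) * (ennreal c + ennreal c)"
      by (intro order_trans[OF nn_integral_powr_diff_le] mult_left_mono add_mono u_crit v_crit crit) auto
    then show ?thesis
      by (simp add: c_def ennreal_mult'[symmetric] ennreal_plus[symmetric] del: ennreal_plus)
  qed
  have "(\<lambda>m. \<integral>\<^sup>+x. ennreal (\<bar>u (\<sigma> m) x - v x\<bar> powr r) \<partial>M) \<longlonglongrightarrow> 0" if "0 < r" "r < crit" for r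
  proof (rule vitali_convergence[OF _ domain_measurable domain_finite _ _ diff that])
    show "AE x in M. (\<lambda>n. u (\<sigma> n) x - v x) \<longlonglongrightarrow> 0"
      using lim by eventually_elim (simp add: LIM_zero_iff)
  qed (auto simp: zero v_zero)
  then show ?thesis
    using order_le_less_trans[OF v_crit ennreal_less_top] v_zero
    by (intro that[OF \<sigma> v_meas]) (simp_all add: infinity_ennreal_def)
qed

end

section \<open>Change of variables over arbitrary finite index types\<close>

text \<open>The library states the change of variables formula only for well-ordered index types.\<close>

typedef 'n ordered_index = "UNIV :: 'n set"
  morphisms to_index of_index by simp

definition index_rank :: "'n::finite \<Rightarrow> nat" where
  "index_rank = (SOME f. inj f)"

lemma inj_index_rank: "inj (index_rank :: 'n::finite \<Rightarrow> nat)"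
proof -
  have "\<exists>f :: 'n \<Rightarrow> nat. inj f"
    using finite_imp_inj_to_nat_seg[of "UNIV :: 'n set"] by auto
  then show ?thesis unfolding index_rank_def by (rule someI_ex)
qed

instance ordered_index :: (finite) finite
proof
  have "(UNIV :: 'a ordered_index set) = of_index ` (UNIV :: 'a set)"
    by (rule surjI[symmetric]) (rule to_index_inverse)
  then show "finite (UNIV :: 'a ordered_index set)"
    by (rule ssubst) (intro finite_imageI finite)
qed

instantiation ordered_index :: (finite) wellorder
begin

definition less_eq_ordered_index where
  "a \<le> b \<longleftrightarrow> index_rank (to_index a) \<le> index_rank (to_index b)" for a b :: "'a ordered_index"

definition less_ordered_index where
  "a < b \<longleftrightarrow> index_rank (to_index a) < index_rank (to_index b)" for a b :: "'a ordered_index"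

instance
proof
  fix x y :: "'a ordered_index"
  assume "x \<le> y" "y \<le> x"
  then show "x = y"
    by (simp add: less_eq_ordered_index_def inj_eq[OF inj_index_rank] to_index_inject order_antisym_conv)
next
  fix P :: "'a ordered_index \<Rightarrow> bool" and a
  assume step: "\<And>x. (\<And>y. y < x \<Longrightarrow> P y) \<Longrightarrow> P x"
  show "P a"
  proof (induction a rule: measure_induct_rule[of "\<lambda>a. index_rank (to_index a)"])
    case (less x)
    show ?case
      by (rule step, rule less) (simp only: less_ordered_index_def)
  qed
qed (auto simp: less_eq_ordered_index_def less_ordered_index_def)

end

lemma bij_to_index: "bij to_index"
proof (rule bijI')
  show "\<exists>i. j = to_index i" for j :: 'a
    by (intro exI[of _ "of_index j"]) (simp add: of_index_inverse)
qed (simp add: to_index_inject)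

definition reorder :: "real^'n \<Rightarrow> real^'n ordered_index" where
  "reorder x = (\<chi> i. x $ to_index i)"

definition unreorder :: "real^'n ordered_index \<Rightarrow> real^'n" where
  "unreorder y = (\<chi> j. y $ of_index j)"

lemma unreorder_reorder [simp]: "unreorder (reorder x) = x"
  by (simp add: reorder_def unreorder_def of_index_inverse)

lemma reorder_unreorder [simp]: "reorder (unreorder x) = x"
  by (simp add: reorder_def unreorder_def to_index_inverse)

lemma inj_reorder: "inj reorder" and inj_unreorder: "inj unreorder"
  by (rule inj_on_inverseI, rule unreorder_reorder) (rule inj_on_inverseI, rule reorder_unreorder)

lemma linear_reorder: "linear (reorder :: real^'n::finite \<Rightarrow> _)"
  by (rule linearI) (auto simp: reorder_def vec_eq_iff)

lemma linear_unreorder: "linear (unreorder :: _ \<Rightarrow> real^'n::finite)"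
  by (rule linearI) (auto simp: unreorder_def vec_eq_iff)

lemma prod_Basis_vec: "(\<Prod>b\<in>(Basis :: (real^'n::finite) set). g (x \<bullet> b)) = (\<Prod>i\<in>UNIV. g (x $ i))"
proof -
  have "(Basis :: (real^'n) set) = range (\<lambda>i. axis i 1)"
    by (auto simp: Basis_vec_def)
  moreover have "inj (\<lambda>i::'n. axis i (1::real))"
    by (auto simp: inj_def axis_eq_axis)
  ultimately have "(\<Prod>b\<in>(Basis :: (real^'n) set). g (x \<bullet> b)) = (\<Prod>i\<in>UNIV. g (x \<bullet> axis i 1))"
    by (metis (mono_tags, lifting) prod.reindex_cong)
  then show ?thesis
    by (simp add: inner_axis)
qed

text \<open>Relabelling coordinates turns boxes into boxes with the same side lengths, and the
  measure of boxes determines \<open>lborel\<close>.\<close>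

lemma distr_reorder: "distr lborel borel (reorder :: real^'n::finite \<Rightarrow> _) = lborel"
proof (rule lborel_eqI[symmetric])
  have meas: "(reorder :: real^'n \<Rightarrow> _) \<in> borel_measurable borel"
    using linear_reorder by (intro borel_measurable_continuous_onI linear_continuous_on) (simp add: linear_linear)
  fix l u :: "real^'n ordered_index"
  assume le: "\<And>b. b \<in> Basis \<Longrightarrow> l \<bullet> b \<le> u \<bullet> b"
  then have le': "l $ i \<le> u $ i" for i
    using le[of "axis i 1"] by (simp add: inner_axis)
  have "(\<forall>i. l $ i < x $ to_index i \<and> x $ to_index i < u $ i) \<longleftrightarrow>
      (\<forall>j. l $ of_index j < x $ j \<and> x $ j < u $ of_index j)" (is "?A \<longleftrightarrow> ?B") for x :: "real^'n"
  proof
    show ?B if ?A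
    proof
      fix j
      show "l $ of_index j < x $ j \<and> x $ j < u $ of_index j"
        using spec[OF that, of "of_index j"] by (simp add: of_index_inverse)
    qed
    show ?A if ?B
    proof
      fix i
      show "l $ i < x $ to_index i \<and> x $ to_index i < u $ i"
        using spec[OF that, of "to_index i"] by (simp add: to_index_inverse)
    qed
  qed
  then have vimage: "reorder -` box l u = box (unreorder l) (unreorder u)"
    by (simp add: set_eq_iff mem_box_cart reorder_def unreorder_def)
  have "emeasure (distr lborel borel reorder) (box l u) = emeasure lborel (box (unreorder l) (unreorder u))"
    using meas by (simp add: emeasure_distr vimage)
  also have "\<dots> = ennreal (\<Prod>b\<in>Basis. (unreorder u - unreorder l) \<bullet> b)"
  proof (rule emeasure_lborel_box)
    fix b :: "real^'n" assume "b \<in> Basis"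
    then show "unreorder l \<bullet> b \<le> unreorder u \<bullet> b"
      using le' by (auto simp: Basis_vec_def inner_axis unreorder_def)
  qed
  also have "(\<Prod>b\<in>Basis. (unreorder u - unreorder l) \<bullet> b) = (\<Prod>j\<in>UNIV. (unreorder u - unreorder l) $ j)"
    by (rule prod_Basis_vec)
  also have "\<dots> = (\<Prod>i\<in>UNIV. (u - l) $ i)"
    using prod.reindex_bij_betw[OF bij_to_index, of "\<lambda>j. (unreorder u - unreorder l) $ j"]
    by (simp add: unreorder_def to_index_inverse)
  also have "\<dots> = (\<Prod>b\<in>Basis. (u - l) \<bullet> b)"
    by (rule prod_Basis_vec[symmetric])
  finally show "emeasure (distr lborel borel (reorder :: real^'n \<Rightarrow> _)) (box l u) = ennreal (\<Prod>b\<in>Basis. (u - l) \<bullet> b)" .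
qed simp

lemma measure_reorder_image:
  fixes S :: "(real^'n::finite) set"
  assumes "S \<in> sets borel"
  shows "reorder ` S \<in> sets borel" "measure lebesgue (reorder ` S) = measure lebesgue S"
proof -
  have image: "reorder ` S = unreorder -` S"
    by (auto simp: image_iff intro!: bexI[of _ "unreorder _"])
  have unmeas: "(unreorder :: _ \<Rightarrow> real^'n) \<in> borel_measurable borel"
    using linear_unreorder by (intro borel_measurable_continuous_onI linear_continuous_on) (simp add: linear_linear)
  have meas: "(reorder :: real^'n \<Rightarrow> _) \<in> borel_measurable borel"
    using linear_reorder by (intro borel_measurable_continuous_onI linear_continuous_on) (simp add: linear_linear)
  show b: "reorder ` S \<in> sets borel"
    using measurable_sets[OF unmeas assms] by (simp add: image)
  have "reorder -` (reorder ` S) = S"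
    by (auto simp: image)
  then have "emeasure lborel (reorder ` S) = emeasure lborel S"
    using meas b by (subst distr_reorder[symmetric]) (simp add: emeasure_distr)
  then show "measure lebesgue (reorder ` S) = measure lebesgue S"
    using b assms by (simp add: measure_def)
qed

text \<open>The determinant of a linear map, taken in the relabelled copy so that it is literally
  the integrand of the change of variables formula there.\<close>

definition jacobian_det :: "(real^'n::finite \<Rightarrow> real^'n) \<Rightarrow> real" where
  "jacobian_det L = det (matrix (reorder \<circ> L \<circ> unreorder))"

lemma jacobian_det_compose:
  assumes "linear L" "linear L'"
  shows "jacobian_det (L \<circ> L') = jacobian_det L * jacobian_det L'"
proof -
  have "reorder \<circ> (L \<circ> L') \<circ> unreorder = (reorder \<circ> L \<circ> unreorder) \<circ> (reorder \<circ> L' \<circ> unreorder)"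
    by (simp add: fun_eq_iff)
  moreover have "linear (reorder \<circ> L \<circ> unreorder)" "linear (reorder \<circ> L' \<circ> unreorder)"
    using assms by (intro linear_compose linear_reorder linear_unreorder; simp)+
  ultimately show ?thesis
    by (simp add: jacobian_det_def matrix_compose det_mul)
qed

lemma jacobian_det_id: "jacobian_det (\<lambda>x :: real^'n::finite. x) = 1"
proof -
  have "reorder \<circ> (\<lambda>x :: real^'n. x) \<circ> unreorder = id" by (simp add: fun_eq_iff)
  then show ?thesis by (simp only: jacobian_det_def matrix_id_mat_1 det_I)
qed

lemma unreorder_axis: "unreorder (axis i 1) = axis (to_index i) 1"
  by (auto simp: unreorder_def axis_def vec_eq_iff of_index_inverse to_index_inverse)

lemma jacobian_det_diagonal:
  "jacobian_det (\<lambda>x. \<chi> j. c j * x $ j) = (\<Prod>j\<in>UNIV. c j)"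
proof -
  let ?A = "matrix (reorder \<circ> (\<lambda>x. \<chi> j. c j * x $ j) \<circ> unreorder)"
  have entry: "?A $ i $ j = (if i = j then c (to_index i) else 0)" for i j
    by (simp add: matrix_def unreorder_axis) (simp add: reorder_def axis_def to_index_inject)
  have "det ?A = (\<Prod>i\<in>UNIV. ?A $ i $ i)"
    by (rule det_diagonal) (simp add: entry)
  also have "\<dots> = (\<Prod>i\<in>UNIV. c (to_index i))"
    by (simp add: entry)
  also have "\<dots> = (\<Prod>j\<in>UNIV. c j)"
    by (rule prod.reindex_bij_betw[OF bij_to_index])
  finally show ?thesis by (simp add: jacobian_det_def)
qed

lemma continuous_on_det:
  fixes A :: "'a::topological_space \<Rightarrow> real^'n^'n"
  assumes "\<And>i j. continuous_on S (\<lambda>z. A z $ i $ j)"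
  shows "continuous_on S (\<lambda>z. det (A z))"
  unfolding det_def
  by (intro continuous_on_sum continuous_on_mult continuous_on_const continuous_on_prod assms)

lemma continuous_on_jacobian_det:
  assumes "\<And>v. continuous_on S (\<lambda>z. L z v)"
  shows "continuous_on S (\<lambda>z. jacobian_det (L z))"
  unfolding jacobian_det_def
proof (rule continuous_on_det)
  fix i j
  show "continuous_on S (\<lambda>z. matrix (reorder \<circ> L z \<circ> unreorder) $ i $ j)"
    unfolding matrix_def reorder_def by (simp add: continuous_on_vec_lambda) (intro continuous_intros assms)
qed

text \<open>Conjugation with \<open>reorder\<close> preserves measures and moves the map to a
  well-ordered index type. There the integrand of the change of variables formula is the constant
  \<open>c\<close>, integrable on a bounded set.\<close>

lemma measure_image_constant_jacobian:
  fixes f :: "real^'n::finite \<Rightarrow> real^'n"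
  assumes S: "open S" "bounded S" and inj: "inj f" and op: "open (f ` S)"
    and der: "\<And>x. (f has_derivative f' x) (at x)"
    and jac: "\<And>x. \<bar>jacobian_det (f' x)\<bar> = c"
  shows "f ` S \<in> lmeasurable" "measure lebesgue (f ` S) = c * measure lebesgue S"
proof -
  have cont: "continuous_on UNIV f"
    by (intro continuous_at_imp_continuous_on ballI has_derivative_continuous[OF der])
  have "bounded (f ` closure S)"
    using S by (intro compact_imp_bounded compact_continuous_image continuous_on_subset[OF cont]) auto
  then have bdd: "bounded (f ` S)"
    by (rule bounded_subset) (use closure_subset in blast)
  then show "f ` S \<in> lmeasurable"
    using op by (rule lmeasurable_open)
  define g where "g = reorder \<circ> f \<circ> unreorder"
  define T where "T = reorder ` S"
  have T: "T \<in> sets borel" "measure lebesgue T = measure lebesgue S"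
    unfolding T_def by (rule measure_reorder_image[OF borel_open[OF S(1)]])+
  have "bounded T"
    unfolding T_def using S linear_reorder by (intro bounded_linear_image) (auto simp: linear_linear)
  then have T_meas: "T \<in> lmeasurable"
    using T by (intro bounded_set_imp_lmeasurable) auto
  have gT: "g ` T = reorder ` (f ` S)"
    by (auto simp: g_def T_def image_image)
  have "measure lebesgue (f ` S) = measure lebesgue (g ` T)"
    unfolding gT using op by (intro measure_reorder_image(2)[symmetric] borel_open)
  also have "\<dots> = integral T (\<lambda>y. \<bar>det (matrix (reorder \<circ> f' (unreorder y) \<circ> unreorder))\<bar>)"
  proof (rule measure_differentiable_image_eq)
    show "T \<in> sets lebesgue" using T by simp
    show "inj_on g T"
      unfolding g_def
      by (rule inj_on_subset[OF inj_compose[OF inj_compose[OF inj_reorder inj] inj_unreorder]]) simp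
    show "(\<lambda>y. \<bar>det (matrix (reorder \<circ> f' (unreorder y) \<circ> unreorder))\<bar>) integrable_on T"
      using jac integrable_on_const[OF T_meas] by (simp add: jacobian_det_def)
    fix y assume "y \<in> T"
    show "(g has_derivative reorder \<circ> f' (unreorder y) \<circ> unreorder) (at y within T)"
      unfolding g_def
      by (rule has_derivative_at_withinI[OF diff_chain_at[OF linear_imp_has_derivative[OF linear_unreorder]
            diff_chain_at[OF der linear_imp_has_derivative[OF linear_reorder]], unfolded o_assoc]])
  qed
  also have "\<dots> = integral T (\<lambda>y. c * 1)"
    using jac by (simp add: jacobian_det_def)
  also have "\<dots> = c * measure lebesgue S"
    unfolding integral_mult_right using lmeasure_integral[OF T_meas] T by simp
  finally show "measure lebesgue (f ` S) = c * measure lebesgue S" .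
qed

lemma sigma_finite_lebesgue: "sigma_finite_measure (lebesgue :: 'a::euclidean_space measure)"
proof
  obtain A :: "nat \<Rightarrow> 'a set" where A: "range A \<subseteq> sets lborel" "(\<Union>i. A i) = space lborel"
      "\<And>i. emeasure lborel (A i) \<noteq> \<infinity>"
    using lborel.sigma_finite by metis
  then have "A i \<in> sets lborel" for i by auto
  with A show "\<exists>A::'a set set. countable A \<and> A \<subseteq> sets lebesgue \<and> \<Union>A = space lebesgue \<and> (\<forall>a\<in>A. emeasure lebesgue a \<noteq> \<infinity>)"
    by (intro exI[of _ "range A"]) auto
qed

section \<open>Lebesgue measure on stratified groups\<close>

context stratified_lie_group
begin

lemma in_carrier [simp]: "x \<in> carrier G"
  by (simp add: carrier_eq)

lemma mult_zero [simp]: "x \<otimes> 0 = x" "0 \<otimes> x = x"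
  using l_one[of x] r_one[of x] by (simp_all add: one_eq)

definition mult_deriv :: "(real^'n) \<times> (real^'n) \<Rightarrow> (real^'n) \<times> (real^'n) \<Rightarrow> real^'n" where
  "mult_deriv z = frechet_derivative (\<lambda>z. fst z \<otimes> snd z) (at z)"

lemma has_derivative_mult: "((\<lambda>z. fst z \<otimes> snd z) has_derivative mult_deriv z) (at z)"
proof -
  have "Ck_map (Suc 0) (\<lambda>z. fst z \<otimes> snd z)"
    using smooth_mult unfolding smooth_map_def by blast
  then show ?thesis
    unfolding mult_deriv_def Ck_map.simps frechet_derivative_works by blast
qed

lemma continuous_on_mult_deriv: "continuous_on UNIV (\<lambda>z. mult_deriv z v)"
proof -
  have "Ck_map (Suc 0) (\<lambda>z. fst z \<otimes> snd z)"
    using smooth_mult unfolding smooth_map_def by blast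
  then show ?thesis
    unfolding mult_deriv_def Ck_map.simps by blast
qed

lemma continuous_on_inv: "continuous_on UNIV (\<lambda>x. inv x)"
  using smooth_inv unfolding smooth_map_def by (metis Ck_map.simps(1))

lemma continuous_on_group_mult [continuous_intros]:
  assumes "continuous_on S f" "continuous_on S g"
  shows "continuous_on S (\<lambda>x. f x \<otimes> g x)"
proof -
  have "continuous_on UNIV (\<lambda>z. fst z \<otimes> snd z)"
    using smooth_mult unfolding smooth_map_def by (metis Ck_map.simps(1))
  from continuous_on_compose2[OF this continuous_on_Pair[OF assms]] show ?thesis by simp
qed

lemma continuous_on_group_inv [continuous_intros]:
  assumes "continuous_on S f"
  shows "continuous_on S (\<lambda>x. inv (f x))"
  using continuous_on_compose2[OF continuous_on_inv assms] by simp

text \<open>The partial derivative of the product in its second argument, extracted from the joint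
  derivative so that it is continuous in both base points together.\<close>

definition translation_deriv :: "(real^'n) \<times> (real^'n) \<Rightarrow> real^'n \<Rightarrow> real^'n" where
  "translation_deriv z v = mult_deriv z (0, v)"

lemma has_derivative_translation:
  "((\<lambda>y. x \<otimes> y) has_derivative translation_deriv (x, y)) (at y)"
proof -
  have "((\<lambda>y. (x, y)) has_derivative (\<lambda>v. (0, v))) (at y)"
    by (intro derivative_intros)
  from diff_chain_at[OF this has_derivative_mult] show ?thesis
    by (simp add: o_def translation_deriv_def[abs_def])
qed

section \<open>Dilations and the Jacobian of translations\<close>

lemma linear_dilation: "linear (dilation w t :: real^'n \<Rightarrow> real^'n)"
  by (rule linearI) (auto simp: dilation_def vec_eq_iff algebra_simps)

lemma dilation_mult: "0 < t \<Longrightarrow> dilation w t (x \<otimes> y) = dilation w t x \<otimes> dilation w t y"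
  using dilation_aut[of t] by (auto simp: iso_def hom_def)

lemma dilation_zero [simp]: "dilation w t 0 = (0 :: real^'n)"
  by (simp add: dilation_def vec_eq_iff)

lemma dilation_inv: "0 < t \<Longrightarrow> dilation w t (inv x) = inv (dilation w t x)"
  using dilation_mult[of t "inv x" x] l_inv[of x]
  by (intro inv_equality[symmetric]) (auto simp: one_eq)

lemma dilation_inverse: "0 < t \<Longrightarrow> dilation w (1 / t) (dilation w t x) = x"
  by (simp add: dilation_def vec_eq_iff power_divide)

lemma dilation_inverse': "0 < t \<Longrightarrow> dilation w t (dilation w (1 / t) x) = x"
  by (simp add: dilation_def vec_eq_iff power_divide)

text \<open>The determinant of a dilation produces the dimension in this form, coordinate by
  coordinate.\<close>

lemma homogeneous_dim_eq: "homogeneous_dim k w = (\<Sum>j\<in>UNIV. w j)"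
proof -
  have "(\<Sum>j\<in>UNIV. w j) = (\<Sum>i = 1..k. \<Sum>j\<in>{j \<in> UNIV. w j = i}. w j)"
    using blocks by (intro sum.group[symmetric]) auto
  also have "\<dots> = (\<Sum>i = 1..k. i * card {j. w j = i})"
    by (intro sum.cong refl) (simp add: mult.commute)
  finally show ?thesis by (simp add: homogeneous_dim_def)
qed

lemma jacobian_det_dilation: "jacobian_det (dilation w t :: real^'n \<Rightarrow> _) = t ^ homogeneous_dim k w"
  using jacobian_det_diagonal[of "\<lambda>j. t ^ w j"]
  by (simp add: dilation_def[abs_def] power_sum homogeneous_dim_eq)

lemma linear_translation_deriv: "linear (translation_deriv z)"
  using has_derivative_linear[OF has_derivative_translation[of "fst z" "snd z"]] by simp

text \<open>The chain rule applied to D_t(x y) = D_t(x) D_t(y) as a function of y; D_t is linear and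
  so is its own derivative.\<close>

lemma translation_deriv_dilation:
  assumes t: "0 < t"
  shows "translation_deriv (dilation w t x, dilation w t y) \<circ> dilation w t = dilation w t \<circ> translation_deriv (x, y)"
proof -
  have "((\<lambda>a. dilation w t x \<otimes> a) \<circ> dilation w t has_derivative
      translation_deriv (dilation w t x, dilation w t y) \<circ> dilation w t) (at y)"
    by (rule diff_chain_at[OF linear_imp_has_derivative[OF linear_dilation] has_derivative_translation])
  moreover have "(dilation w t \<circ> (\<lambda>a. x \<otimes> a) has_derivative dilation w t \<circ> translation_deriv (x, y)) (at y)"
    by (rule diff_chain_at[OF has_derivative_translation linear_imp_has_derivative[OF linear_dilation]])
  moreover have "(\<lambda>a. dilation w t x \<otimes> a) \<circ> dilation w t = dilation w t \<circ> (\<lambda>a. x \<otimes> a)"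
    using dilation_mult[OF t] by (simp add: fun_eq_iff)
  ultimately show ?thesis
    by (metis has_derivative_unique)
qed

lemma tendsto_dilation_zero: "((\<lambda>t. dilation w t x) \<longlongrightarrow> (0 :: real^'n)) (at_right 0)"
proof (rule vec_tendstoI)
  fix j
  have "w j \<noteq> 0" using blocks[of j] by auto
  then have "((\<lambda>t::real. t ^ w j * x $ j) \<longlongrightarrow> 0 ^ w j * x $ j) (at_right 0)"
    by (intro tendsto_intros)
  with \<open>w j \<noteq> 0\<close> show "((\<lambda>t. dilation w t x $ j) \<longlongrightarrow> (0 :: real^'n) $ j) (at_right 0)"
    by (simp add: dilation_def power_0_left)
qed

lemma jacobian_det_translation: "jacobian_det (translation_deriv (x, y)) = 1"
proof -
  let ?J = "\<lambda>z. jacobian_det (translation_deriv z)"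
  have inv: "?J (dilation w t x, dilation w t y) = ?J (x, y)" if t: "0 < t" for t
  proof -
    have "?J (dilation w t x, dilation w t y) * t ^ homogeneous_dim k w = t ^ homogeneous_dim k w * ?J (x, y)"
      using arg_cong[OF translation_deriv_dilation[OF t, of x y], of jacobian_det]
      by (simp add: jacobian_det_compose linear_translation_deriv linear_dilation jacobian_det_dilation)
    then show ?thesis using t by simp
  qed
  \<comment> \<open>Both base points shrink with \<open>t\<close>, so continuity in the pair is
    required.\<close>
  have "continuous_on UNIV ?J"
    unfolding translation_deriv_def by (intro continuous_on_jacobian_det continuous_on_mult_deriv)
  then have "isCont ?J (0, 0)"
    by (simp add: continuous_on_eq_continuous_at)
  then have "((\<lambda>t. ?J (dilation w t x, dilation w t y)) \<longlongrightarrow> ?J (0, 0)) (at_right 0)"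
    by (rule isCont_tendsto_compose) (intro tendsto_Pair tendsto_dilation_zero)
  moreover have "((\<lambda>t. ?J (dilation w t x, dilation w t y)) \<longlongrightarrow> ?J (x, y)) (at_right 0)"
    by (rule tendsto_eventually) (auto simp: eventually_at_right_less eventually_at_filter inv)
  ultimately have "?J (x, y) = ?J (0, 0)"
    by (rule tendsto_unique[OF trivial_limit_at_right_real, symmetric])
  also have "translation_deriv (0, 0) = (\<lambda>v. v)"
    using has_derivative_unique[OF has_derivative_translation[of 0 0]] by (simp add: has_derivative_ident)
  finally show ?thesis by (simp add: jacobian_det_id)
qed

end

section \<open>Quasi-balls and their measure\<close>

locale quasi_normed_stratified_group = stratified_lie_group G k w
  for G :: "(real^'n::finite) monoid" (structure) and k w +
  fixes q :: "real^'n \<Rightarrow> real"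
  assumes quasi_norm: "homogeneous_quasi_norm G w q"
begin

lemma q_cont: "continuous_on UNIV q"
  and q_nonneg: "0 \<le> q x"
  and q_zero: "q x = 0 \<longleftrightarrow> x = 0"
  and q_inv: "q (inv x) = q x"
  and q_dilation: "0 < t \<Longrightarrow> q (dilation w t x) = t * q x"
  using quasi_norm unfolding homogeneous_quasi_norm_def by blast+

lemma continuous_on_q [continuous_intros]:
  "continuous_on S f \<Longrightarrow> continuous_on S (\<lambda>x. q (f x))"
  by (rule continuous_on_compose2[OF q_cont]) auto

definition unit_ball :: "(real^'n) set" where
  "unit_ball = {a. q a < 1}"

definition qball :: "real^'n \<Rightarrow> real \<Rightarrow> (real^'n) set" where
  "qball x r = {y. q (inv y \<otimes> x) < r}"

lemma open_qball: "open (qball x r)"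
  unfolding qball_def by (intro open_Collect_less continuous_intros)

lemma open_unit_ball: "open unit_ball"
  unfolding unit_ball_def by (intro open_Collect_less continuous_intros)

lemma zero_in_unit_ball: "0 \<in> unit_ball"
  using q_zero[of 0] by (simp add: unit_ball_def)

text \<open>Let c > 0 be the minimum of \<open>q\<close> on the Euclidean unit sphere. A point of
  norm at least 1 is dilated onto the sphere by some t <= 1, so its quasi-norm is at least c. Hence
  D_c maps the quasi-ball into the Euclidean ball.\<close>

lemma bounded_unit_ball: "bounded unit_ball"
proof -
  have w_pos: "w j \<noteq> 0" for j using blocks[of j] by auto
  have "compact (q ` sphere 0 1)"
    by (intro compact_continuous_image continuous_on_subset[OF q_cont]) auto
  moreover have "sphere (0::real^'n) 1 \<noteq> {}" by simp
  ultimately obtain x0 where x0: "x0 \<in> sphere 0 1" and min: "\<And>x. x \<in> sphere 0 1 \<Longrightarrow> q x0 \<le> q x"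
    using continuous_attains_inf[of "sphere (0::real^'n) 1" q] continuous_on_subset[OF q_cont] by auto
  define c where "c = q x0"
  have "x0 \<noteq> 0" using x0 by auto
  then have c: "0 < c" using q_nonneg[of x0] q_zero[of x0] by (simp add: c_def)
  have far: "c \<le> q x" if x: "1 \<le> norm x" for x
  proof -
    \<comment> \<open>The intermediate value theorem along the orbit of \<open>x\<close>; all
      weights are positive, so the orbit starts at 0.\<close>
    have "continuous_on {0..1} (\<lambda>t. norm (dilation w t x))"
      unfolding dilation_def
      by (intro continuous_intros)
    moreover have "dilation w 0 x = 0"
      by (simp add: dilation_def vec_eq_iff power_0_left w_pos)
    moreover have "dilation w 1 x = x"
      by (simp add: dilation_def vec_eq_iff)
    ultimately obtain t where t: "0 \<le> t" "t \<le> 1" "norm (dilation w t x) = 1"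
      using IVT'[of "\<lambda>t. norm (dilation w t x)" 0 1 1] x by auto
    have "t \<noteq> 0" using t(3) \<open>dilation w 0 x = 0\<close> by auto
    with t have t0: "0 < t" by simp
    have "c \<le> q (dilation w t x)" unfolding c_def by (rule min) (simp add: t)
    also have "\<dots> = t * q x" by (rule q_dilation[OF t0])
    also have "\<dots> \<le> 1 * q x" using t q_nonneg by (intro mult_right_mono) auto
    finally show ?thesis by simp
  qed
  have "unit_ball \<subseteq> dilation w (1 / c) ` ball 0 1"
  proof
    fix a assume "a \<in> unit_ball"
    then have "q (dilation w c a) < c"
      using c by (simp add: unit_ball_def q_dilation)
    then have "dilation w c a \<in> ball 0 1"
      using far[of "dilation w c a"] by force
    then show "a \<in> dilation w (1 / c) ` ball 0 1"
      using dilation_inverse[OF c, of a] by (metis imageI)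
  qed
  moreover have "bounded (dilation w (1 / c) ` ball 0 1 :: (real^'n) set)"
    using linear_dilation by (intro bounded_linear_image bounded_ball) (simp add: linear_linear)
  ultimately show ?thesis by (rule bounded_subset[rotated])
qed

text \<open>For y = x D_r(a) the product y^(-1) x is the inverse of D_r(a), and \<open>q\<close> is
  homogeneous and invariant under inversion.\<close>

lemma qball_eq_image:
  assumes r: "0 < r"
  shows "qball x r = (\<lambda>a. x \<otimes> dilation w r a) ` unit_ball"
proof (intro equalityI subsetI)
  fix y assume "y \<in> qball x r"
  then have y: "q (inv y \<otimes> x) < r" by (simp add: qball_def)
  define a where "a = dilation w (1 / r) (inv x \<otimes> y)"
  have "q a = q (inv x \<otimes> y) / r"
    using r by (simp add: a_def q_dilation)
  also have "q (inv x \<otimes> y) = q (inv y \<otimes> x)"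
    using q_inv[of "inv x \<otimes> y"] by (simp add: inv_mult_group)
  finally have "a \<in> unit_ball" using y r by (simp add: unit_ball_def)
  moreover have "y = x \<otimes> dilation w r a"
    unfolding a_def dilation_inverse'[OF r] by (simp add: m_assoc[symmetric] one_eq)
  ultimately show "y \<in> (\<lambda>a. x \<otimes> dilation w r a) ` unit_ball" by blast
next
  fix y assume "y \<in> (\<lambda>a. x \<otimes> dilation w r a) ` unit_ball"
  then obtain a where a: "q a < 1" "y = x \<otimes> dilation w r a" by (auto simp: unit_ball_def)
  have "inv y \<otimes> x = inv (dilation w r a)"
    by (simp add: a inv_mult_group m_assoc one_eq)
  then have "q (inv y \<otimes> x) = r * q a"
    using r by (simp add: q_inv q_dilation)
  then show "y \<in> qball x r" using a r by (simp add: qball_def)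
qed

lemma measure_qball:
  assumes r: "0 < r"
  shows "qball x r \<in> lmeasurable"
    "measure lebesgue (qball x r) = r ^ homogeneous_dim k w * measure lebesgue unit_ball"
proof -
  let ?f = "\<lambda>a. x \<otimes> dilation w r a"
  have inj: "inj ?f"
  proof (rule injI)
    fix a b assume "?f a = ?f b"
    then have "dilation w r a = dilation w r b" by simp
    then show "a = b" using dilation_inverse[OF r] by metis
  qed
  have der: "(?f has_derivative translation_deriv (x, dilation w r a) \<circ> dilation w r) (at a)" for a
    using diff_chain_at[OF linear_imp_has_derivative[OF linear_dilation] has_derivative_translation]
    by (simp add: o_def)
  have jac: "\<bar>jacobian_det (translation_deriv (x, dilation w r a) \<circ> dilation w r)\<bar> = r ^ homogeneous_dim k w" for a
    using r by (simp add: jacobian_det_compose linear_translation_deriv linear_dilation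
        jacobian_det_dilation jacobian_det_translation)
  have op: "open (?f ` unit_ball)"
    using open_qball qball_eq_image[OF r] by metis
  note * = measure_image_constant_jacobian[OF open_unit_ball bounded_unit_ball inj op der jac]
  show "qball x r \<in> lmeasurable"
    "measure lebesgue (qball x r) = r ^ homogeneous_dim k w * measure lebesgue unit_ball"
    using * by (simp_all add: qball_eq_image[OF r])
qed

lemma measure_unit_ball_pos: "0 < measure lebesgue unit_ball"
proof -
  have "unit_ball \<in> lmeasurable"
    by (rule lmeasurable_open[OF bounded_unit_ball open_unit_ball])
  moreover have "\<not> negligible unit_ball"
    using open_not_negligible[OF open_unit_ball] zero_in_unit_ball by blast
  ultimately show ?thesis
    using negligible_iff_measure0 zero_less_measure_iff by blast
qed

end

section \<open>The embeddings\<close>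

lemma ennreal_pow_le_iff:
  assumes "0 < t" "0 \<le> b"
  shows "ennreal_pow a t \<le> ennreal b \<longleftrightarrow> a \<le> ennreal (b powr (1 / t))"
proof (cases a)
  case (real x)
  have "x powr t \<le> b \<longleftrightarrow> x \<le> b powr (1 / t)"
  proof
    assume "x powr t \<le> b"
    then have "(x powr t) powr (1 / t) \<le> b powr (1 / t)"
      using assms by (intro powr_mono2) auto
    then show "x \<le> b powr (1 / t)" using real assms by (simp add: powr_powr)
  next
    assume "x \<le> b powr (1 / t)"
    then have "x powr t \<le> (b powr (1 / t)) powr t"
      using real assms by (intro powr_mono2) auto
    then show "x powr t \<le> b" using assms by (simp add: powr_powr)
  qed
  then show ?thesis using real assms by (simp add: ennreal_pow_def)
next
  case top
  then show ?thesis by (simp add: ennreal_pow_def top_unique)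
qed

lemma tendsto_ennreal_pow_zero:
  assumes "0 < t" "(a \<longlongrightarrow> 0) F"
  shows "((\<lambda>n. ennreal_pow (a n) t) \<longlongrightarrow> 0) F"
proof (rule order_tendstoI)
  fix y :: ennreal assume "0 < y"
  then obtain \<epsilon> where \<epsilon>: "0 < \<epsilon>" "ennreal \<epsilon> < y" by (rule ennreal_between_0)
  have "\<forall>\<^sub>F n in F. a n < ennreal (\<epsilon> powr (1 / t))"
    using \<epsilon> by (intro order_tendstoD(2)[OF assms(2)]) auto
  then show "\<forall>\<^sub>F n in F. ennreal_pow (a n) t < y"
  proof eventually_elim
    case (elim n)
    then have "ennreal_pow (a n) t \<le> ennreal \<epsilon>"
      using ennreal_pow_le_iff[OF assms(1)] \<epsilon> by simp
    then show ?case using \<epsilon>(2) by (rule order_le_less_trans)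
  qed
qed simp

text \<open>Replaces an inequality between extended norms by one for real bounds m > 0, where powers
  can be computed. For x = 0 every such m is admissible and C m is arbitrarily small; for infinite x
  the right side is infinite because C > 0.\<close>

lemma ennreal_le_homogeneous:
  assumes C: "0 < C" and le: "\<And>m. 0 < m \<Longrightarrow> x \<le> ennreal m \<Longrightarrow> y \<le> ennreal (C * m)"
  shows "y \<le> ennreal C * x"
proof (cases x)
  case (real a)
  show ?thesis
  proof (cases "a = 0")
    case True
    have "y \<le> 0"
    proof (rule ennreal_le_epsilon)
      fix \<epsilon> :: real assume "0 < \<epsilon>"
      then have "y \<le> ennreal (C * (\<epsilon> / C))"
        using C real True by (intro le) auto
      then show "y \<le> 0 + ennreal \<epsilon>" using C by simp
    qed
    then show ?thesis by simp
  next
    case False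
    with real have "y \<le> ennreal (C * a)" by (intro le) auto
    then show ?thesis using real C by (simp add: ennreal_mult'')
  qed
next
  case top
  then show ?thesis using C by (simp add: ennreal_mult_top)
qed

lemma Lp_norm_eq:
  fixes u :: "real^'n::finite \<Rightarrow> real"
  assumes "\<Omega> \<in> sets lebesgue" "\<And>x. x \<notin> \<Omega> \<Longrightarrow> u x = 0"
  shows "Lp_norm r \<Omega> u = ennreal_pow (\<integral>\<^sup>+x. ennreal (\<bar>u x\<bar> powr r) \<partial>lebesgue) (1 / r)"
proof -
  have "(\<integral>\<^sup>+x. ennreal (\<bar>u x\<bar> powr r) \<partial>lebesgue_on \<Omega>) = (\<integral>\<^sup>+x. ennreal (\<bar>u x\<bar> powr r) * indicator \<Omega> x \<partial>lebesgue)"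
    using assms(1) by (intro nn_integral_restrict_space) simp
  also have "\<dots> = (\<integral>\<^sup>+x. ennreal (\<bar>u x\<bar> powr r) \<partial>lebesgue)"
    using assms(2) by (intro nn_integral_cong) (auto simp: indicator_def)
  finally show ?thesis by (simp add: Lp_norm_def)
qed

section \<open>The group as an instance of the abstract setting\<close>

locale fractional_sobolev_setting = quasi_normed_stratified_group G k w q
  for G :: "(real^'n::finite) monoid" (structure) and k w q +
  fixes s p :: real and \<Omega> :: "(real^'n) set"
  assumes s_pos: "0 < s" and p_gt_1: "1 < p" and subcritical: "s * p < real (homogeneous_dim k w)"
    and open_domain: "open \<Omega>"
begin

abbreviation "Q \<equiv> homogeneous_dim k w"

lemma translated_quasi_norm_measurable:
  "(\<lambda>z. q (inv (snd z) \<otimes> fst z)) \<in> borel_measurable (lebesgue \<Otimes>\<^sub>M lebesgue)"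
proof -
  have "(\<lambda>z. q (inv (snd z) \<otimes> fst z)) \<in> borel_measurable (borel :: ((real^'n) \<times> (real^'n)) measure)"
    by (intro borel_measurable_continuous_onI continuous_intros)
  \<comment> \<open>A product of completions has at least the measurable sets of the Borel product,
    so the identity is measurable in this direction.\<close>
  moreover have "(\<lambda>z. (fst z, snd z)) \<in> lebesgue \<Otimes>\<^sub>M lebesgue \<rightarrow>\<^sub>M (borel :: ((real^'n) \<times> (real^'n)) measure)"
    unfolding borel_prod[symmetric]
    by (intro measurable_Pair measurable_compose[OF measurable_fst] measurable_compose[OF measurable_snd] measurable_completion) auto
  ultimately show ?thesis
    by (auto dest: measurable_compose[rotated])
qed

sublocale fractional_kernel lebesgue "\<lambda>x y. q (inv y \<otimes> x)" "measure lebesgue unit_ball" "real Q" s p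
proof (intro fractional_kernel.intro fractional_kernel_axioms.intro sigma_finite_lebesgue)
  fix x y assume "q (inv y \<otimes> x) = 0"
  then have "inv y \<otimes> x = \<one>" by (simp add: q_zero one_eq)
  then have "y \<otimes> (inv y \<otimes> x) = y" by simp
  then show "x = y" by (simp add: m_assoc[symmetric])
next
  fix x :: "real^'n" and r :: real assume r: "0 < r"
  have "ennreal (measure lebesgue unit_ball * r powr real Q) = ennreal (measure lebesgue (qball x r))"
    using r by (simp add: measure_qball powr_realpow mult.commute)
  also have "\<dots> = emeasure lebesgue (qball x r)"
    using measure_qball(1)[OF r, of x] by (simp add: emeasure_eq_measure2)
  finally show "ennreal (measure lebesgue unit_ball * r powr real Q) \<le> emeasure lebesgue {y \<in> space lebesgue. q (inv y \<otimes> x) < r}"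
    by (simp add: qball_def)
qed (simp_all add: translated_quasi_norm_measurable q_nonneg measure_unit_ball_pos s_pos p_gt_1 subcritical)

section \<open>From norms to integrals; continuous embeddings\<close>

lemma domain_sets: "\<Omega> \<in> sets lebesgue"
  using open_domain by simp

lemma gagliardo_seminorm_eq: "gagliardo_seminorm G q Q s p u = ennreal_pow (energy u) (1 / p)"
  by (simp add: gagliardo_seminorm_def energy_def quotient_def case_prod_beta')

lemma X0_norm_bounds:
  assumes u: "u \<in> X0_space G q Q s p \<Omega>" and m: "X0_norm G q Q s p \<Omega> u \<le> ennreal m" "0 \<le> m"
  shows "(\<integral>\<^sup>+x. ennreal (\<bar>u x\<bar> powr p) \<partial>lebesgue) \<le> ennreal (m powr p)" "energy u \<le> ennreal (m powr p)"
proof -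
  have zero: "\<And>x. x \<notin> \<Omega> \<Longrightarrow> u x = 0" using u by (simp add: X0_space_def)
  have "Lp_norm p \<Omega> u \<le> ennreal m" "gagliardo_seminorm G q Q s p u \<le> ennreal m"
    by (rule order_trans[OF _ m(1)], simp add: X0_norm_def)+
  then show "(\<integral>\<^sup>+x. ennreal (\<bar>u x\<bar> powr p) \<partial>lebesgue) \<le> ennreal (m powr p)" "energy u \<le> ennreal (m powr p)"
    using p_gt_1 m(2) by (simp_all add: Lp_norm_eq[OF domain_sets zero] gagliardo_seminorm_eq ennreal_pow_le_iff)
qed

text \<open>Reduces an embedding to an estimate of integrals under a norm bound \<open>m\<close>.
  The factor m^r keeps \<open>c\<close> independent of \<open>m\<close>, and c^(1/r) is the
  embedding constant.\<close>

lemma continuous_embedding_criterion: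
  assumes r: "0 < r" and c: "0 < c"
    and bound: "\<And>u m. u \<in> borel_measurable lebesgue \<Longrightarrow> (\<And>x. x \<notin> \<Omega> \<Longrightarrow> u x = 0) \<Longrightarrow> 0 < m \<Longrightarrow>
      (\<integral>\<^sup>+x. ennreal (\<bar>u x\<bar> powr p) \<partial>lebesgue) \<le> ennreal (m powr p) \<Longrightarrow>
      energy u \<le> ennreal (m powr p) \<Longrightarrow>
      (\<integral>\<^sup>+x. ennreal (\<bar>u x\<bar> powr r) \<partial>lebesgue) \<le> ennreal (c * m powr r)"
  shows "continuous_embedding (X0_space G q Q s p \<Omega>) (X0_norm G q Q s p \<Omega>) (Lp_space r \<Omega>) (Lp_norm r \<Omega>)"
proof -
  define C where "C = c powr (1 / r)"
  have C: "0 < C" using c by (simp add: C_def)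
  have ineq: "Lp_norm r \<Omega> u \<le> ennreal C * X0_norm G q Q s p \<Omega> u" if u: "u \<in> X0_space G q Q s p \<Omega>" for u
  proof (rule ennreal_le_homogeneous[OF C])
    fix m :: real assume m: "0 < m" "X0_norm G q Q s p \<Omega> u \<le> ennreal m"
    have meas: "u \<in> borel_measurable lebesgue" and zero: "\<And>x. x \<notin> \<Omega> \<Longrightarrow> u x = 0"
      using u by (simp_all add: X0_space_def)
    have "(\<integral>\<^sup>+x. ennreal (\<bar>u x\<bar> powr r) \<partial>lebesgue) \<le> ennreal (c * m powr r)"
      by (intro bound meas zero m X0_norm_bounds u less_imp_le)
    also have "c * m powr r = (C * m) powr r"
      using r c m by (simp add: C_def powr_mult powr_powr)
    finally show "Lp_norm r \<Omega> u \<le> ennreal (C * m)"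
      using r C m by (simp add: Lp_norm_eq[OF domain_sets zero] ennreal_pow_le_iff)
  qed
  have "u \<in> Lp_space r \<Omega>" if u: "u \<in> X0_space G q Q s p \<Omega>" for u
  proof -
    have "X0_norm G q Q s p \<Omega> u < \<infinity>" "u \<in> borel_measurable lebesgue"
      using u by (simp_all add: X0_space_def)
    then have "ennreal C * X0_norm G q Q s p \<Omega> u < \<infinity>" "u \<in> borel_measurable (lebesgue_on \<Omega>)"
      by (simp_all add: ennreal_mult_less_top measurable_restrict_space1)
    with ineq[OF u] show ?thesis
      unfolding Lp_space_def by (simp add: order_le_less_trans[OF ineq[OF u]])
  qed
  with C ineq show ?thesis
    unfolding continuous_embedding_def by (intro conjI subsetI exI[of _ C] ballI)
qed

lemma sobolev_homogeneous:
  assumes "u \<in> borel_measurable lebesgue" "0 < m"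
    and "(\<integral>\<^sup>+x. ennreal (\<bar>u x\<bar> powr p) \<partial>lebesgue) \<le> ennreal (m powr p)" "energy u \<le> ennreal (m powr p)"
  shows "(\<integral>\<^sup>+x. ennreal (\<bar>u x\<bar> powr crit) \<partial>lebesgue) \<le> ennreal (sobolev_const powr (crit / p) * m powr crit)"
proof -
  have "(\<integral>\<^sup>+x. ennreal (\<bar>u x\<bar> powr crit) \<partial>lebesgue) \<le> ennreal ((sobolev_const * m powr p) powr (crit / p))"
    using order_le_less_trans[OF assms(3) ennreal_less_top] by (intro sobolev assms) auto
  also have "(sobolev_const * m powr p) powr (crit / p) = sobolev_const powr (crit / p) * m powr crit"
    using p_gt_1 by (simp add: powr_mult powr_powr)
  finally show ?thesis .
qed

text \<open>|u|^r is compared with |u|^p below the height \<open>m\<close> and with |u|^crit above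
  it. With the norm bound itself as the height, both terms are multiples of m^r.\<close>

lemma embedding_between:
  assumes r: "p \<le> r" "r \<le> crit"
  shows "continuous_embedding (X0_space G q Q s p \<Omega>) (X0_norm G q Q s p \<Omega>) (Lp_space r \<Omega>) (Lp_norm r \<Omega>)"
proof (rule continuous_embedding_criterion)
  let ?K = "sobolev_const powr (crit / p)"
  show "0 < r" using r p_gt_1 by simp
  show "0 < 1 + ?K" by (simp add: add_pos_nonneg)
  fix u :: "real^'n \<Rightarrow> real" and m :: real
  assume [measurable]: "u \<in> borel_measurable lebesgue" and m: "0 < m"
    and p_bd: "(\<integral>\<^sup>+x. ennreal (\<bar>u x\<bar> powr p) \<partial>lebesgue) \<le> ennreal (m powr p)"
    and en: "energy u \<le> ennreal (m powr p)"
  have pt: "\<bar>z\<bar> powr r \<le> m powr (r - p) * \<bar>z\<bar> powr p + m powr (r - crit) * \<bar>z\<bar> powr crit" for z :: real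
  proof (cases "\<bar>z\<bar> \<le> m")
    case True
    have "\<bar>z\<bar> powr r = \<bar>z\<bar> powr (r - p) * \<bar>z\<bar> powr p"
      by (simp add: powr_add[symmetric])
    also have "\<dots> \<le> m powr (r - p) * \<bar>z\<bar> powr p"
      using True m r by (intro mult_right_mono powr_mono2) auto
    finally show ?thesis by (simp add: add_increasing2)
  next
    case False
    then show ?thesis
      using powr_split_at[OF m r(2), of z] by (simp add: add_increasing)
  qed
  have "(\<integral>\<^sup>+x. ennreal (\<bar>u x\<bar> powr r) \<partial>lebesgue) \<le>
      (\<integral>\<^sup>+x. ennreal (m powr (r - p)) * ennreal (\<bar>u x\<bar> powr p) + ennreal (m powr (r - crit)) * ennreal (\<bar>u x\<bar> powr crit) \<partial>lebesgue)"
    using pt by (intro nn_integral_mono) (simp add: ennreal_mult'[symmetric] ennreal_plus[symmetric] del: ennreal_plus)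
  also have "\<dots> = ennreal (m powr (r - p)) * (\<integral>\<^sup>+x. ennreal (\<bar>u x\<bar> powr p) \<partial>lebesgue) +
      ennreal (m powr (r - crit)) * (\<integral>\<^sup>+x. ennreal (\<bar>u x\<bar> powr crit) \<partial>lebesgue)"
    by (simp add: nn_integral_add nn_integral_cmult)
  also have "\<dots> \<le> ennreal (m powr (r - p)) * ennreal (m powr p) +
      ennreal (m powr (r - crit)) * ennreal (?K * m powr crit)"
    using m p_bd en by (intro add_mono mult_left_mono sobolev_homogeneous) auto
  also have "\<dots> = ennreal ((1 + ?K) * m powr r)"
    using m by (simp add: ennreal_mult'[symmetric] ennreal_plus[symmetric] powr_diff distrib_right del: ennreal_plus)
  finally show "(\<integral>\<^sup>+x. ennreal (\<bar>u x\<bar> powr r) \<partial>lebesgue) \<le> ennreal ((1 + ?K) * m powr r)" .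
qed

text \<open>Below the height \<open>m\<close>, |u|^r is bounded by the constant m^r on \<Omega>,
  which has finite measure; this admits exponents below \<open>p\<close>.\<close>

lemma embedding_bounded:
  assumes bdd: "bounded \<Omega>" and r: "1 \<le> r" "r \<le> crit"
  shows "continuous_embedding (X0_space G q Q s p \<Omega>) (X0_norm G q Q s p \<Omega>) (Lp_space r \<Omega>) (Lp_norm r \<Omega>)"
proof (rule continuous_embedding_criterion)
  let ?K = "sobolev_const powr (crit / p)" and ?\<mu> = "measure lebesgue \<Omega>"
  have \<mu>: "emeasure lebesgue \<Omega> = ennreal ?\<mu>"
    using lmeasurable_open[OF bdd open_domain] by (simp add: emeasure_eq_measure2)
  show "0 < r" using r by simp
  show "0 < ?\<mu> + ?K" using sobolev_const_pos by (simp add: add_nonneg_pos)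
  fix u :: "real^'n \<Rightarrow> real" and m :: real
  assume [measurable]: "u \<in> borel_measurable lebesgue" and m: "0 < m"
    and zero: "\<And>x. x \<notin> \<Omega> \<Longrightarrow> u x = 0"
    and p_bd: "(\<integral>\<^sup>+x. ennreal (\<bar>u x\<bar> powr p) \<partial>lebesgue) \<le> ennreal (m powr p)"
    and en: "energy u \<le> ennreal (m powr p)"
  note [measurable] = domain_sets
  have pt: "\<bar>z\<bar> powr r \<le> m powr r + m powr (r - crit) * \<bar>z\<bar> powr crit" for z :: real
    using powr_split_at[OF m r(2), of z]
  proof
    assume "\<bar>z\<bar> \<le> m"
    then have "\<bar>z\<bar> powr r \<le> m powr r" using r by (intro powr_mono2) auto
    then show ?thesis by (simp add: add_increasing2)
  qed (simp add: add_increasing)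
  have "(\<integral>\<^sup>+x. ennreal (\<bar>u x\<bar> powr r) \<partial>lebesgue) \<le>
      (\<integral>\<^sup>+x. ennreal (m powr r) * indicator \<Omega> x + ennreal (m powr (r - crit)) * ennreal (\<bar>u x\<bar> powr crit) \<partial>lebesgue)"
  proof (intro nn_integral_mono)
    fix x
    show "ennreal (\<bar>u x\<bar> powr r) \<le> ennreal (m powr r) * indicator \<Omega> x + ennreal (m powr (r - crit)) * ennreal (\<bar>u x\<bar> powr crit)"
    proof (cases "x \<in> \<Omega>")
      case True
      then show ?thesis
        using pt[of "u x"] by (simp add: ennreal_mult'[symmetric] ennreal_plus[symmetric] del: ennreal_plus)
    next
      case False
      then show ?thesis by (simp add: zero)
    qed
  qed
  also have "\<dots> = ennreal (m powr r) * ennreal ?\<mu> +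
      ennreal (m powr (r - crit)) * (\<integral>\<^sup>+x. ennreal (\<bar>u x\<bar> powr crit) \<partial>lebesgue)"
    by (simp add: nn_integral_add nn_integral_cmult \<mu>)
  also have "\<dots> \<le> ennreal (m powr r) * ennreal ?\<mu> + ennreal (m powr (r - crit)) * ennreal (?K * m powr crit)"
    using m p_bd en by (intro add_mono mult_left_mono sobolev_homogeneous) auto
  also have "\<dots> = ennreal (m powr r * ?\<mu> + m powr (r - crit) * (?K * m powr crit))"
    by (simp add: ennreal_mult'[symmetric] ennreal_plus[symmetric] del: ennreal_plus)
  also have "m powr r * ?\<mu> + m powr (r - crit) * (?K * m powr crit) = (?\<mu> + ?K) * m powr r"
    using m by (simp add: powr_diff algebra_simps)
  finally show "(\<integral>\<^sup>+x. ennreal (\<bar>u x\<bar> powr r) \<partial>lebesgue) \<le> ennreal ((?\<mu> + ?K) * m powr r)" .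
qed

section \<open>Covers by quasi-balls; the compact embedding\<close>

lemma qball_diameter:
  obtains K where "0 < K"
    "\<forall>\<delta>>0. \<forall>x0. \<forall>x\<in>qball x0 \<delta>. \<forall>y\<in>qball x0 \<delta>. q (inv y \<otimes> x) \<le> K * \<delta>"
proof -
  let ?g = "\<lambda>z. q (inv (snd z) \<otimes> fst z)"
  \<comment> \<open>Left invariance and homogeneity reduce the claim to unit scale, where
    \<open>?g\<close> is continuous on a compact set.\<close>
  have "compact (?g ` (closure unit_ball \<times> closure unit_ball))"
    using bounded_unit_ball
    by (intro compact_continuous_image compact_Times continuous_intros) (auto simp: compact_closure)
  then have "bdd_above (?g ` (closure unit_ball \<times> closure unit_ball))"
    by (intro bounded_imp_bdd_above compact_imp_bounded)
  then obtain K where K: "\<And>z. z \<in> closure unit_ball \<times> closure unit_ball \<Longrightarrow> ?g z \<le> K"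
    unfolding bdd_above_def by blast
  \<comment> \<open>The maximum with 1 secures positivity.\<close>
  show ?thesis
  proof (rule that[of "max K 1"])
    show "\<forall>\<delta>>0. \<forall>x0. \<forall>x\<in>qball x0 \<delta>. \<forall>y\<in>qball x0 \<delta>. q (inv y \<otimes> x) \<le> max K 1 * \<delta>"
    proof (intro allI impI ballI)
      fix x0 x y :: "real^'n" and \<delta> :: real
      assume \<delta>: "0 < \<delta>" and xy: "x \<in> qball x0 \<delta>" "y \<in> qball x0 \<delta>"
      obtain a where a: "a \<in> unit_ball" "x = x0 \<otimes> dilation w \<delta> a"
        using xy(1) unfolding qball_eq_image[OF \<delta>] by (rule imageE)
      obtain b where b: "b \<in> unit_ball" "y = x0 \<otimes> dilation w \<delta> b"
        using xy(2) unfolding qball_eq_image[OF \<delta>] by (rule imageE)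
      have "inv y \<otimes> x = inv (dilation w \<delta> b) \<otimes> (inv x0 \<otimes> (x0 \<otimes> dilation w \<delta> a))"
        by (simp add: a b inv_mult_group m_assoc)
      also have "inv x0 \<otimes> (x0 \<otimes> dilation w \<delta> a) = dilation w \<delta> a"
        by (simp add: m_assoc[symmetric] one_eq)
      also have "inv (dilation w \<delta> b) \<otimes> dilation w \<delta> a = dilation w \<delta> (inv b \<otimes> a)"
        using \<delta> by (simp add: dilation_mult dilation_inv)
      finally have "q (inv y \<otimes> x) = \<delta> * q (inv b \<otimes> a)"
        using \<delta> by (simp add: q_dilation)
      also have "q (inv b \<otimes> a) \<le> max K 1"
        using K[of "(a, b)"] subsetD[OF closure_subset a(1)] subsetD[OF closure_subset b(1)]
        by (simp add: le_max_iff_disj)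
      finally show "q (inv y \<otimes> x) \<le> max K 1 * \<delta>"
        using \<delta> by (simp add: mult.commute)
    qed
  qed simp
qed

lemma center_in_qball: "0 < r \<Longrightarrow> x \<in> qball x r"
  using q_zero[of 0] by (simp add: qball_def one_eq)

lemma totally_bounded:
  assumes bdd: "bounded \<Omega>"
  obtains K where
    "totally_bounded_domain lebesgue (\<lambda>x y. q (inv y \<otimes> x)) (measure lebesgue unit_ball) (real Q) s p \<Omega> K"
proof -
  obtain K where K: "0 < K"
    "\<forall>\<delta>>0. \<forall>x0. \<forall>x\<in>qball x0 \<delta>. \<forall>y\<in>qball x0 \<delta>. q (inv y \<otimes> x) \<le> K * \<delta>"
    by (rule qball_diameter)
  have cover: "\<exists>\<B>. finite \<B> \<and> \<Omega> \<subseteq> \<Union>\<B> \<and> (\<forall>B\<in>\<B>. B \<in> sets lebesgue \<and> emeasure lebesgue B < \<infinity> \<and>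
      measure lebesgue unit_ball * \<delta> powr real Q \<le> measure lebesgue B \<and>
      (\<forall>x\<in>B. \<forall>y\<in>B. q (inv y \<otimes> x) \<le> K * \<delta>))" if \<delta>: "0 < \<delta>" for \<delta>
  proof -
    \<comment> \<open>Centres may lie outside \<Omega>; all quasi-balls of one radius have the same
      measure.\<close>
    have "compact (closure \<Omega>)" using bdd by (simp add: compact_closure)
    moreover have "\<And>x. x \<in> closure \<Omega> \<Longrightarrow> open (qball x \<delta>)" by (rule open_qball)
    moreover have "closure \<Omega> \<subseteq> (\<Union>x\<in>closure \<Omega>. qball x \<delta>)"
      using center_in_qball[OF \<delta>] by blast
    ultimately obtain C where C: "C \<subseteq> closure \<Omega>" "finite C" "closure \<Omega> \<subseteq> (\<Union>x\<in>C. qball x \<delta>)"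
      by (rule compactE_image)
    have "\<forall>B\<in>(\<lambda>x. qball x \<delta>) ` C. B \<in> sets lebesgue \<and> emeasure lebesgue B < \<infinity> \<and>
      measure lebesgue unit_ball * \<delta> powr real Q \<le> measure lebesgue B \<and>
      (\<forall>x\<in>B. \<forall>y\<in>B. q (inv y \<otimes> x) \<le> K * \<delta>)"
    proof (intro ballI, elim imageE, intro conjI ballI)
      fix B x assume B: "B = qball x \<delta>"
      show "B \<in> sets lebesgue" "emeasure lebesgue B < \<infinity>"
        using measure_qball(1)[OF \<delta>, of x] by (simp_all add: B fmeasurableD emeasure_eq_measure2)
      show "measure lebesgue unit_ball * \<delta> powr real Q \<le> measure lebesgue B"
        using \<delta> by (simp add: B measure_qball(2) powr_realpow mult.commute)
      fix y z assume "y \<in> B" "z \<in> B"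
      then show "q (inv z \<otimes> y) \<le> K * \<delta>" using K(2) \<delta> by (simp add: B)
    qed
    moreover have "\<Omega> \<subseteq> \<Union>((\<lambda>x. qball x \<delta>) ` C)"
      using C(3) closure_subset[of \<Omega>] by (rule order_trans[rotated])
    moreover have "finite ((\<lambda>x. qball x \<delta>) ` C)" using C(2) by (rule finite_imageI)
    ultimately show ?thesis by (intro exI[of _ "(\<lambda>x. qball x \<delta>) ` C"] conjI)
  qed
  have "totally_bounded_domain lebesgue (\<lambda>x y. q (inv y \<otimes> x)) (measure lebesgue unit_ball) (real Q) s p \<Omega> K"
  proof (intro totally_bounded_domain.intro totally_bounded_domain_axioms.intro fractional_kernel_axioms cover)
    show "emeasure lebesgue \<Omega> < \<infinity>"
      by (simp add: emeasure_eq_measure2[OF lmeasurable_open[OF bdd open_domain]])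
  qed (simp_all add: domain_sets K)
  then show ?thesis by (rule that)
qed

lemma Lp_space_of_crit:
  assumes bdd: "bounded \<Omega>" and r: "0 < r" "r \<le> crit" and v: "v \<in> borel_measurable lebesgue"
    and zero: "\<And>x. x \<notin> \<Omega> \<Longrightarrow> v x = 0" and fin: "(\<integral>\<^sup>+x. ennreal (\<bar>v x\<bar> powr crit) \<partial>lebesgue) < \<infinity>"
  shows "v \<in> Lp_space r \<Omega>"
proof -
  note [measurable] = v domain_sets
  have "(\<integral>\<^sup>+x. ennreal (\<bar>v x\<bar> powr r) \<partial>lebesgue) \<le> (\<integral>\<^sup>+x. indicator \<Omega> x + ennreal (\<bar>v x\<bar> powr crit) \<partial>lebesgue)"
  proof (intro nn_integral_mono)
    fix x
    have "\<bar>v x\<bar> powr r \<le> 1 + \<bar>v x\<bar> powr crit"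
      using powr_split_at[OF zero_less_one r(2), of "v x"]
    proof
      assume "\<bar>v x\<bar> \<le> 1"
      then have "\<bar>v x\<bar> powr r \<le> 1" using r powr_mono2[of r "\<bar>v x\<bar>" 1] by simp
      then show ?thesis by (simp add: add_increasing2)
    qed simp
    then have "ennreal (\<bar>v x\<bar> powr r) \<le> 1 + ennreal (\<bar>v x\<bar> powr crit)"
      using ennreal_leI by fastforce
    then show "ennreal (\<bar>v x\<bar> powr r) \<le> indicator \<Omega> x + ennreal (\<bar>v x\<bar> powr crit)"
      using zero[of x] by (cases "x \<in> \<Omega>") auto
  qed
  also have "\<dots> = emeasure lebesgue \<Omega> + (\<integral>\<^sup>+x. ennreal (\<bar>v x\<bar> powr crit) \<partial>lebesgue)"
    by (simp add: nn_integral_add)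
  also have "\<dots> < \<infinity>"
    using fin by (simp add: emeasure_eq_measure2[OF lmeasurable_open[OF bdd open_domain]])
  finally have "(\<integral>\<^sup>+x. ennreal (\<bar>v x\<bar> powr r) \<partial>lebesgue) < \<infinity>" .
  then have "Lp_norm r \<Omega> v < \<infinity>"
    by (simp add: Lp_norm_eq[OF domain_sets zero] ennreal_pow_def less_top[symmetric])
  then show ?thesis
    using measurable_restrict_space1[OF v] by (simp add: Lp_space_def)
qed

lemma compact_embedding_bounded:
  assumes bdd: "bounded \<Omega>" and r: "1 \<le> r" "r < crit"
  shows "compact_embedding (X0_space G q Q s p \<Omega>) (X0_norm G q Q s p \<Omega>) (Lp_space r \<Omega>) (Lp_norm r \<Omega>)"
  unfolding compact_embedding_def
proof (intro conjI allI impI)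
  show "X0_space G q Q s p \<Omega> \<subseteq> Lp_space r \<Omega>"
    using embedding_bounded[OF bdd r(1)] r(2) by (simp add: continuous_embedding_def)
next
  fix u :: "nat \<Rightarrow> real^'n \<Rightarrow> real"
  assume "(\<forall>m. u m \<in> X0_space G q Q s p \<Omega>) \<and> (\<exists>M. \<forall>m. X0_norm G q Q s p \<Omega> (u m) \<le> ennreal M)"
  then obtain M where u: "\<forall>m. u m \<in> X0_space G q Q s p \<Omega>"
    and M: "\<forall>m. X0_norm G q Q s p \<Omega> (u m) \<le> ennreal M"
    by (elim conjE exE)
  obtain K where "totally_bounded_domain lebesgue (\<lambda>x y. q (inv y \<otimes> x)) (measure lebesgue unit_ball) (real Q) s p \<Omega> K"
    by (rule totally_bounded[OF bdd])
  then interpret T: totally_bounded_domain lebesgue "\<lambda>x y. q (inv y \<otimes> x)" "measure lebesgue unit_ball" "real Q" s p \<Omega> K .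
  \<comment> \<open>\<open>ennreal\<close> sends negative reals to 0, so a negative \<open>M\<close>
    can be replaced by 0, as \<open>X0_norm_bounds\<close> requires.\<close>
  have M': "X0_norm G q Q s p \<Omega> (u m) \<le> ennreal (max M 0)" for m
    by (rule order_trans[OF spec[OF M] ennreal_leI]) simp
  have meas: "u m \<in> borel_measurable lebesgue" and zero: "\<And>x. x \<notin> \<Omega> \<Longrightarrow> u m x = 0" for m
    using u by (simp_all add: X0_space_def)
  note bounds = X0_norm_bounds[OF spec[OF u] M' max.cobounded2]
  obtain \<sigma> v where \<sigma>: "strict_mono \<sigma>" and v: "v \<in> borel_measurable lebesgue"
    "(\<integral>\<^sup>+x. ennreal (\<bar>v x\<bar> powr crit) \<partial>lebesgue) < \<infinity>" "\<forall>x. x \<notin> \<Omega> \<longrightarrow> v x = 0"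
    and lim: "\<forall>r>0. r < crit \<longrightarrow> (\<lambda>m. \<integral>\<^sup>+x. ennreal (\<bar>u (\<sigma> m) x - v x\<bar> powr r) \<partial>lebesgue) \<longlonglongrightarrow> 0"
    by (rule T.compactness[where u = u, OF meas zero bounds powr_ge_zero])
  have "v \<in> Lp_space r \<Omega>"
    using r v(3) by (intro Lp_space_of_crit bdd v(1,2)) auto
  moreover have "(\<lambda>m. Lp_norm r \<Omega> (\<lambda>x. u (\<sigma> m) x - v x)) \<longlonglongrightarrow> 0"
  proof -
    have "Lp_norm r \<Omega> (\<lambda>x. u (\<sigma> m) x - v x) =
        ennreal_pow (\<integral>\<^sup>+x. ennreal (\<bar>u (\<sigma> m) x - v x\<bar> powr r) \<partial>lebesgue) (1 / r)" for m
      by (rule Lp_norm_eq[OF domain_sets]) (simp add: zero v)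
    then show ?thesis
      using r by (simp add: tendsto_ennreal_pow_zero lim)
  qed
  ultimately show "\<exists>v\<in>Lp_space r \<Omega>. \<exists>\<sigma>. strict_mono \<sigma> \<and> (\<lambda>m. Lp_norm r \<Omega> (\<lambda>x. u (\<sigma> m) x - v x)) \<longlonglongrightarrow> 0"
    using \<sigma> by (intro bexI[of _ v] exI[of _ \<sigma>] conjI)
qed

end

theorem theorem1p1:
  fixes G :: "(real^'n::finite) monoid" and k :: nat and w :: "'n \<Rightarrow> nat"
    and q :: "real^'n \<Rightarrow> real" and Q :: nat and s p p_star :: real
    and \<Omega> :: "(real^'n) set"
  assumes "stratified_lie_group G k w"
    and "homogeneous_quasi_norm G w q"
    and "Q = homogeneous_dim k w"
    and "0 < s" and "s < 1" and "1 < p"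
    and "real Q > s * p"
    and "p_star = real Q * p / (real Q - s * p)"
    and "open \<Omega>"
  shows "(\<forall>r. p \<le> r \<and> r \<le> p_star \<longrightarrow>
            continuous_embedding (X0_space G q Q s p \<Omega>) (X0_norm G q Q s p \<Omega>)
              (Lp_space r \<Omega>) (Lp_norm r \<Omega>)) \<and>
         (bounded \<Omega> \<longrightarrow>
            (\<forall>r. 1 \<le> r \<and> r \<le> p_star \<longrightarrow>
               continuous_embedding (X0_space G q Q s p \<Omega>) (X0_norm G q Q s p \<Omega>)
                 (Lp_space r \<Omega>) (Lp_norm r \<Omega>)) \<and>
            (\<forall>r. 1 \<le> r \<and> r < p_star \<longrightarrow>
               compact_embedding (X0_space G q Q s p \<Omega>) (X0_norm G q Q s p \<Omega>)
                 (Lp_space r \<Omega>) (Lp_norm r \<Omega>)))"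
proof -
  interpret F: fractional_sobolev_setting G k w q s p \<Omega>
    using assms
    by (intro fractional_sobolev_setting.intro quasi_normed_stratified_group.intro
        quasi_normed_stratified_group_axioms.intro fractional_sobolev_setting_axioms.intro) simp_all
  have star: "p_star = F.crit"
    using assms by (simp add: F.crit_def)
  show ?thesis
    unfolding star \<open>Q = homogeneous_dim k w\<close>
    using F.embedding_between F.embedding_bounded F.compact_embedding_bounded by blast
qed

end
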